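(* Let $G=(V,E)$ be a locally finite graph. Assume that its (positive) edge weights satisfy $w_{xy}=w_{yx}$ for all $y\sim x\in V$, and that its measure satisfies $\mu(x)\ge\mu_{\min}>0$ for all $x\in V$, where $\mu_{\min}$ is a constant. Let $h:V\to\mathbb{R}$ be a function such that (i) there exists a constant $h_0>0$ with $h(x)\ge h_0$ for all $x\in V$; (ii) $h(x)\to+\infty$ as $\mathrm{dist}(x,x_0)\to+\infty$ for some fixed $x_0\in V$. Let $f:V\times\mathbb{R}\to\mathbb{R}$ be a function satisfying, with $F(x,s)=\int_0^s f(x,t)\,dt$: (a) for any $s,t\in\mathbb{R}$, there exists some constant $L>0$ such that $|f(x,s)-f(x,t)|\le L|s-t|$ for all $x\in V$; (b) there exists a constant $\theta>2$ such that $0<\theta F(x,s)\le s f(x,s)$ for all $x\in V$ and $s>0$; (c) for all $x\in V$, $\limsup_{s\to0+}\frac{2F(x,s)}{s^2}<\lambda_1$, where $\lambda_1=\inf_{\int_V u^2d\mu=1}\int_V(|\nabla u|^2+hu^2)\,d\mu$. Suppose that $g\in\mathscr{H}'$ satisfies $g(x)\ge0$ for all $x\in V$ and $g\not\equiv0$. Then there exists a constant $\epsilon_1>0$ such that for any $0<\epsilon<\epsilon_1$ the equation $-\Delta u+hu=f(x,u)+\epsilon g$ on $V$ has two distinct strictly positive solutions (functions $u:V\to\mathbb{R}$ with $u(x)>0$ for all $x\in V$ satisfying the equation at every $x\in V$).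
   Context: $G=(V,E)$ is a graph with vertex set $V$ and edge set $E$; $y\sim x$ means $xy\in E$. Locally finite means each $x\in V$ has only finitely many $y$ with $xy\in E$. Each edge $xy$ carries a weight $w_{xy}>0$. $\mathrm{dist}(x,y)$ is the graph distance (minimal number of edges of a path from $x$ to $y$). The measure is a function $\mu:V\to(0,\infty)$, and $\int_V g\,d\mu=\sum_{x\in V}\mu(x)g(x)$. The Laplacian is $\Delta u(x)=\frac{1}{\mu(x)}\sum_{y\sim x}w_{xy}(u(y)-u(x))$, and $|\nabla u|(x)=\left(\frac{1}{2\mu(x)}\sum_{y\sim x}w_{xy}(u(y)-u(x))^2\right)^{1/2}$. $C_c(V)$ is the set of functions on $V$ with compact (finite) support; $W^{1,2}(V)$ is the completion of $C_c(V)$ under $\|u\|_{W^{1,2}(V)}=\left(\int_V(|\nabla u|^2+u^2)d\mu\right)^{1/2}$. $\mathscr{H}=\{u\in W^{1,2}(V):\int_V hu^2d\mu<+\infty\}$ with norm $\|u\|_{\mathscr{H}}=\left(\int_V(|\nabla u|^2+hu^2)d\mu\right)^{1/2}$, a Hilbert space; the infimum defining $\lambda_1$ is over $u\in\mathscr{H}$ with $\int_Vu^2d\mu=1$. $\mathscr{H}'$ is the dual space of $\mathscr{H}$; a function $g:V\to\mathbb{R}$ belongs to $\mathscr{H}'$ if $\varphi\mapsto\int_Vg\varphi\,d\mu$, $\varphi\in C_c(V)$, is bounded for the norm $\|\cdot\|_{\mathscr{H}}$, and $g$ is then identified with the continuous extension of this functional to $\mathscr{H}$ ($C_c(V)$ is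 dense in $\mathscr{H}$).
   Formalization: Condition (a) is taken as: for every M>0 there is L>0 with |f(x,s)-f(x,t)| ≤ L|s-t| for all x in V and s,t in [-M,M]. With L depending on the pair s,t the claim fails for discontinuous f; with one L for all s,t it contradicts (b). *)

theory Defs
  imports "HOL-Analysis.Analysis"
begin

text \<open>
  The vertex set of the graph is the type \<open>'v\<close>. The edge set is a symmetric relation \<open>E\<close>, so
  \<open>E `` {x}\<close> is the set of neighbours of \<open>x\<close>. Weights are indexed by ordered pairs, and only their
  values on \<open>E\<close> matter. Loops are not excluded: they contribute nothing to any of the notions below.
\<close>

text \<open>
  \<open>(x, y) \<in> E ^^ n\<close> means that \<open>n\<close> successive edges lead from \<open>x\<close> to \<open>y\<close>. The distance is
  \<open>\<infinity>\<close> if \<open>x\<close> and \<open>y\<close> are not connected (infimum of the empty set).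
\<close>
definition graph_dist :: "('v \<times> 'v) set \<Rightarrow> 'v \<Rightarrow> 'v \<Rightarrow> enat" where
  "graph_dist E x y = (INF n\<in>{n. (x, y) \<in> E ^^ n}. enat n)"

definition vint :: "('v \<Rightarrow> real) \<Rightarrow> ('v \<Rightarrow> real) \<Rightarrow> real" where
  "vint \<mu> g = (\<Sum>\<^sub>\<infinity>x. \<mu> x * g x)"

definition laplacian ::
  "('v \<times> 'v) set \<Rightarrow> ('v \<Rightarrow> 'v \<Rightarrow> real) \<Rightarrow> ('v \<Rightarrow> real) \<Rightarrow> ('v \<Rightarrow> real) \<Rightarrow> 'v \<Rightarrow> real" where
  "laplacian E w \<mu> u x = 1 / \<mu> x * (\<Sum>y\<in>E `` {x}. w x y * (u y - u x))"

definition grad_norm ::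
  "('v \<times> 'v) set \<Rightarrow> ('v \<Rightarrow> 'v \<Rightarrow> real) \<Rightarrow> ('v \<Rightarrow> real) \<Rightarrow> ('v \<Rightarrow> real) \<Rightarrow> 'v \<Rightarrow> real" where
  "grad_norm E w \<mu> u x = sqrt (1 / (2 * \<mu> x) * (\<Sum>y\<in>E `` {x}. w x y * (u y - u x)\<^sup>2))"

definition Cc :: "('v \<Rightarrow> real) set" where
  "Cc = {u. finite {x. u x \<noteq> 0}}"

definition W12_norm ::
  "('v \<times> 'v) set \<Rightarrow> ('v \<Rightarrow> 'v \<Rightarrow> real) \<Rightarrow> ('v \<Rightarrow> real) \<Rightarrow> ('v \<Rightarrow> real) \<Rightarrow> real" where
  "W12_norm E w \<mu> u = sqrt (vint \<mu> (\<lambda>x. (grad_norm E w \<mu> u x)\<^sup>2 + (u x)\<^sup>2))"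

text \<open>
  The completion of \<open>Cc\<close> under \<open>W12_norm\<close>, realised as a space of functions: the class of a Cauchy
  sequence is represented by its pointwise limit. The limit exists because
  \<open>\<mu> x * (u x)\<^sup>2 \<le> (W12_norm E w \<mu> u)\<^sup>2\<close> on \<open>Cc\<close>, and by Fatou's lemma it determines the class,
  has finite norm, and the sequence converges to it in norm.
\<close>
definition W12 ::
  "('v \<times> 'v) set \<Rightarrow> ('v \<Rightarrow> 'v \<Rightarrow> real) \<Rightarrow> ('v \<Rightarrow> real) \<Rightarrow> ('v \<Rightarrow> real) set" where
  "W12 E w \<mu> = {u. \<exists>\<phi> :: nat \<Rightarrow> 'v \<Rightarrow> real.
      (\<forall>n. \<phi> n \<in> Cc) \<and>
      (\<forall>e>0. \<exists>N. \<forall>m\<ge>N. \<forall>n\<ge>N. W12_norm E w \<mu> (\<lambda>x. \<phi> m x - \<phi> n x) < e) \<and>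
      (\<forall>x. (\<lambda>n. \<phi> n x) \<longlonglongrightarrow> u x)}"

text \<open>Summability expresses finiteness of the integral, since the theory is only used with \<open>h > 0\<close>.\<close>
definition H_space ::
  "('v \<times> 'v) set \<Rightarrow> ('v \<Rightarrow> 'v \<Rightarrow> real) \<Rightarrow> ('v \<Rightarrow> real) \<Rightarrow> ('v \<Rightarrow> real) \<Rightarrow> ('v \<Rightarrow> real) set" where
  "H_space E w \<mu> h = {u \<in> W12 E w \<mu>. (\<lambda>x. \<mu> x * (h x * (u x)\<^sup>2)) summable_on UNIV}"

definition H_norm ::
  "('v \<times> 'v) set \<Rightarrow> ('v \<Rightarrow> 'v \<Rightarrow> real) \<Rightarrow> ('v \<Rightarrow> real) \<Rightarrow> ('v \<Rightarrow> real) \<Rightarrow> ('v \<Rightarrow> real) \<Rightarrow> real" where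
  "H_norm E w \<mu> h u = sqrt (vint \<mu> (\<lambda>x. (grad_norm E w \<mu> u x)\<^sup>2 + h x * (u x)\<^sup>2))"

text \<open>
  The functions \<open>g\<close> that represent an element of the dual of \<open>H_space E w \<mu> h\<close>: the functional
  \<open>\<phi> \<mapsto> vint \<mu> (\<lambda>x. g x * \<phi> x)\<close> on the dense subspace \<open>Cc\<close> is bounded and so extends.
\<close>
definition H_dual ::
  "('v \<times> 'v) set \<Rightarrow> ('v \<Rightarrow> 'v \<Rightarrow> real) \<Rightarrow> ('v \<Rightarrow> real) \<Rightarrow> ('v \<Rightarrow> real) \<Rightarrow> ('v \<Rightarrow> real) set" where
  "H_dual E w \<mu> h =
     {g. \<exists>C. \<forall>\<phi>\<in>Cc. \<bar>vint \<mu> (\<lambda>x. g x * \<phi> x)\<bar> \<le> C * H_norm E w \<mu> h \<phi>}"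

definition lambda1 ::
  "('v \<times> 'v) set \<Rightarrow> ('v \<Rightarrow> 'v \<Rightarrow> real) \<Rightarrow> ('v \<Rightarrow> real) \<Rightarrow> ('v \<Rightarrow> real) \<Rightarrow> real" where
  "lambda1 E w \<mu> h =
     (INF u\<in>{u \<in> H_space E w \<mu> h. vint \<mu> (\<lambda>x. (u x)\<^sup>2) = 1}.
        vint \<mu> (\<lambda>x. (grad_norm E w \<mu> u x)\<^sup>2 + h x * (u x)\<^sup>2))"

definition primitive :: "('v \<Rightarrow> real \<Rightarrow> real) \<Rightarrow> 'v \<Rightarrow> real \<Rightarrow> real" where
  "primitive f x s = (LBINT t=0..s. f x t)"

text \<open>
  The Lipschitz constant is uniform in the vertex and may depend on the range of \<open>s\<close> and \<open>t\<close>.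
  A single constant for all \<open>s\<close> and \<open>t\<close> would contradict superquadratic growth of \<open>primitive f x\<close>,
  while a constant depending on the individual pair \<open>(s, t)\<close> would not even make \<open>f x\<close> continuous.
\<close>
definition loc_lipschitz :: "('v \<Rightarrow> real \<Rightarrow> real) \<Rightarrow> bool" where
  "loc_lipschitz f \<longleftrightarrow>
     (\<forall>M>0. \<exists>L>0. \<forall>s\<in>{-M..M}. \<forall>t\<in>{-M..M}. \<forall>x. \<bar>f x s - f x t\<bar> \<le> L * \<bar>s - t\<bar>)"

definition pos_solution ::
  "('v \<times> 'v) set \<Rightarrow> ('v \<Rightarrow> 'v \<Rightarrow> real) \<Rightarrow> ('v \<Rightarrow> real) \<Rightarrow> ('v \<Rightarrow> real) \<Rightarrow>
   ('v \<Rightarrow> real \<Rightarrow> real) \<Rightarrow> ('v \<Rightarrow> real) \<Rightarrow> real \<Rightarrow> ('v \<Rightarrow> real) \<Rightarrow> bool" where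
  "pos_solution E w \<mu> h f g \<epsilon> u \<longleftrightarrow>
     (\<forall>x. u x > 0) \<and> (\<forall>x. - laplacian E w \<mu> u x + h x * u x = f x (u x) + \<epsilon> * g x)"

end

theory Submission
  imports Defs
begin

text \<open>
  Instead of a mountain pass theorem in \<open>H_space\<close>, the Dirichlet problem is treated on every finite
  vertex set \<open>A\<close>, and everything is kept uniform in \<open>A\<close>. The functional \<open>J A\<close> is nonpositive at
  \<open>0\<close> and at a suitable multiple \<open>e\<close> of the indicator of one vertex, and is at least \<open>\<delta> > 0\<close> on a
  sphere that separates them. Steepest descent with small steps decreases \<open>J A\<close> along whole segments, so
  an orbit that has dropped below \<open>\<delta>\<close> never crosses the sphere. The orbit of \<open>0\<close> therefore stays
  small, and by connectedness of the segment from \<open>0\<close> to \<open>e\<close> some orbit starting on it stays above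
  \<open>\<delta>\<close>; both contain points of arbitrarily small residual. The Ambrosetti-Rabinowitz
  condition bounds their energy independently of \<open>A\<close>, and since \<open>h\<close> is coercive, the mass on one fixed
  finite set \<open>K\<close> tells the two families apart. As the equation at a vertex involves finitely many
  values only, Tychonoff's theorem yields exact solutions on the whole graph, and these are still
  distinguished by their mass on \<open>K\<close>.

  The sphere exists because \<open>primitive f x s / s powr \<theta>\<close> is nondecreasing in \<open>s\<close>: with the Lipschitz
  bound on \<open>[0, 1]\<close> this makes \<open>primitive f x s\<close> of order \<open>s powr \<theta>\<close> near \<open>0\<close>, uniformly in \<open>x\<close>.
\<close>

section \<open>The Schroedinger operator on a weighted graph\<close>

text \<open>The Dirichlet condition is imposed on total functions, so the operator at a vertex of
  \<open>A\<close> still sees the edges leaving \<open>A\<close>.\<close>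

definition supported :: "'v set \<Rightarrow> ('v \<Rightarrow> real) \<Rightarrow> bool" where
  "supported A u \<longleftrightarrow> (\<forall>x. x \<notin> A \<longrightarrow> u x = 0)"

locale weighted_graph =
  fixes E :: "('v \<times> 'v) set" and w :: "'v \<Rightarrow> 'v \<Rightarrow> real" and \<mu> h :: "'v \<Rightarrow> real"
    and \<mu>_min h0 :: real
  assumes graph: "sym E"
    and loc_finite: "finite (E `` {x})"
    and w_pos: "(x, y) \<in> E \<Longrightarrow> w x y > 0"
    and w_sym: "(x, y) \<in> E \<Longrightarrow> w x y = w y x"
    and mu_min_pos: "\<mu>_min > 0"
    and mu_ge: "\<mu> x \<ge> \<mu>_min"
    and h0_pos: "h0 > 0"
    and h_ge: "h x \<ge> h0"
begin

text \<open>The operator -\<Delta> + h multiplied by the measure, which makes it symmetric for the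
  unweighted sum over vertices.\<close>

definition schroedinger :: "('v \<Rightarrow> real) \<Rightarrow> 'v \<Rightarrow> real" where
  "schroedinger u x = (\<Sum>y\<in>E `` {x}. w x y * (u x - u y)) + \<mu> x * h x * u x"

text \<open>The squared \<open>H_norm\<close> of a function supported in the finite set
  \<open>A\<close>, in the form left by summation by parts.\<close>

definition energy :: "'v set \<Rightarrow> ('v \<Rightarrow> real) \<Rightarrow> real" where
  "energy A u = (\<Sum>x\<in>A. u x * schroedinger u x)"

lemma mu_pos: "\<mu> x > 0"
  using mu_min_pos mu_ge[of x] by linarith

lemma h_pos: "h x > 0"
  using h0_pos h_ge[of x] by linarith

lemma schroedinger_eq_laplacian:
  "schroedinger u x = \<mu> x * (- laplacian E w \<mu> u x + h x * u x)"
proof -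
  have "(\<Sum>y\<in>E `` {x}. w x y * (u x - u y)) = - (\<Sum>y\<in>E `` {x}. w x y * (u y - u x))"
    by (simp add: sum_negf[symmetric] algebra_simps)
  then show ?thesis
    using mu_pos[of x] by (simp add: schroedinger_def laplacian_def algebra_simps)
qed

lemma schroedinger_add_scaleR:
  "schroedinger (\<lambda>y. u y + s * d y) x = schroedinger u x + s * schroedinger d x"
  by (simp add: schroedinger_def algebra_simps sum.distrib sum_distrib_left sum_subtractf)

section \<open>Green's formula and the energy form\<close>

text \<open>Summation by parts: every edge is counted from both ends, and the symmetry of
  \<open>w\<close> merges the two contributions, whence the factor 1/2. The sum runs over
  \<open>B\<close> because an edge leaving \<open>A\<close> carries gradient at both of its
  ends.\<close>

lemma greens_formula:
  assumes A: "finite A" and u: "supported A u" and v: "supported A v"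
    and B: "B = A \<union> E `` A"
  shows "(\<Sum>x\<in>A. v x * schroedinger u x) =
    (\<Sum>x\<in>B. \<Sum>y\<in>E `` {x}. w x y * ((u y - u x) * (v y - v x))) / 2 + (\<Sum>x\<in>A. \<mu> x * h x * u x * v x)"
proof -
  have finB: "finite B"
    using A loc_finite unfolding B by (metis Image_eq_UN finite_UN finite_UnI)
  \<comment> \<open>Weights extended by zero let all inner sums run over the same finite set
    \<open>B\<close>, so that the order of summation can be exchanged.\<close>
  define a where "a x y = (if (x, y) \<in> E then w x y else 0)" for x y
  have a_sym: "a x y = a y x" for x y
    using graph w_sym by (auto simp: a_def sym_def)
  have nb: "(\<Sum>y\<in>E `` {x}. w x y * k y) = (\<Sum>y\<in>B. a x y * k y)"
    if "\<And>y. (x, y) \<in> E \<Longrightarrow> y \<notin> B \<Longrightarrow> k y = 0" for x k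
  proof -
    have "(\<Sum>y\<in>E `` {x}. w x y * k y) = (\<Sum>y\<in>E `` {x} \<inter> B. w x y * k y)"
      by (rule sum.mono_neutral_right) (use loc_finite that in auto)
    also have "\<dots> = (\<Sum>y\<in>E `` {x} \<inter> B. a x y * k y)"
      by (rule sum.cong) (auto simp: a_def)
    also have "\<dots> = (\<Sum>y\<in>B. a x y * k y)"
      by (rule sum.mono_neutral_left) (use finB in \<open>auto simp: a_def\<close>)
    finally show ?thesis .
  qed
  have off: "x \<notin> B \<Longrightarrow> u x = 0" "x \<notin> B \<Longrightarrow> v x = 0" for x
    using u v by (auto simp: supported_def B)
  have inner: "(\<Sum>y\<in>E `` {x}. w x y * ((u y - u x) * (v y - v x))) =
      (\<Sum>y\<in>B. a x y * ((u y - u x) * (v y - v x)))" if "x \<in> B" for x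
  proof (rule nb)
    fix y assume "(x, y) \<in> E" "y \<notin> B"
    then have "x \<notin> A" "y \<notin> A"
      by (auto simp: B)
    then show "(u y - u x) * (v y - v x) = 0"
      using u v by (simp add: supported_def)
  qed
  let ?S = "\<Sum>x\<in>B. \<Sum>y\<in>B. a x y * (v x * (u x - u y))"
  have "(\<Sum>x\<in>A. v x * (\<Sum>y\<in>E `` {x}. w x y * (u x - u y))) =
      (\<Sum>x\<in>A. v x * (\<Sum>y\<in>B. a x y * (u x - u y)))"
  proof (rule sum.cong[OF refl])
    fix x assume "x \<in> A"
    then have "(\<Sum>y\<in>E `` {x}. w x y * (u x - u y)) = (\<Sum>y\<in>B. a x y * (u x - u y))"
      by (intro nb) (auto simp: B)
    then show "v x * (\<Sum>y\<in>E `` {x}. w x y * (u x - u y)) = v x * (\<Sum>y\<in>B. a x y * (u x - u y))"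
      by simp
  qed
  also have "\<dots> = (\<Sum>x\<in>B. v x * (\<Sum>y\<in>B. a x y * (u x - u y)))"
    by (rule sum.mono_neutral_left) (use finB v in \<open>auto simp: B supported_def\<close>)
  also have "\<dots> = ?S"
    by (simp add: sum_distrib_left mult_ac)
  finally have 1: "(\<Sum>x\<in>A. v x * (\<Sum>y\<in>E `` {x}. w x y * (u x - u y))) = ?S" .
  \<comment> \<open>Exchanging the ends of each edge gives a second form of \<open>?S\<close>;
    adding the two forms produces the product of the differences.\<close>
  have "?S = (\<Sum>y\<in>B. \<Sum>x\<in>B. a x y * (v x * (u x - u y)))"
    by (rule sum.swap)
  also have "\<dots> = (\<Sum>x\<in>B. \<Sum>y\<in>B. a x y * (v y * (u y - u x)))"
    by (intro sum.cong refl) (simp add: a_sym)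
  finally have "?S + ?S = (\<Sum>x\<in>B. \<Sum>y\<in>B. a x y * (v x * (u x - u y)) + a x y * (v y * (u y - u x)))"
    by (simp add: sum.distrib)
  also have "\<dots> = (\<Sum>x\<in>B. \<Sum>y\<in>B. a x y * ((u y - u x) * (v y - v x)))"
    by (intro sum.cong refl) (simp add: algebra_simps)
  also have "\<dots> = (\<Sum>x\<in>B. \<Sum>y\<in>E `` {x}. w x y * ((u y - u x) * (v y - v x)))"
    by (rule sum.cong[OF refl]) (simp add: inner)
  finally show ?thesis
    using 1 by (simp add: schroedinger_def distrib_left sum.distrib mult_ac)
qed

lemma schroedinger_symmetric:
  assumes "finite A" "supported A u" "supported A v"
  shows "(\<Sum>x\<in>A. v x * schroedinger u x) = (\<Sum>x\<in>A. u x * schroedinger v x)"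
  unfolding greens_formula[OF assms refl] greens_formula[OF assms(1,3,2) refl]
  by (simp add: mult_ac)

text \<open>The gradient part of Green's formula is nonnegative, so the potential part alone is a
  lower bound.\<close>

lemma energy_ge:
  assumes "finite A" "supported A u"
  shows "(\<Sum>x\<in>A. \<mu> x * h x * (u x)\<^sup>2) \<le> energy A u"
proof -
  have "0 \<le> (\<Sum>x\<in>A \<union> E `` A. \<Sum>y\<in>E `` {x}. w x y * ((u y - u x) * (u y - u x)))"
    by (intro sum_nonneg mult_nonneg_nonneg[OF less_imp_le[OF w_pos]] zero_le_square) auto
  then show ?thesis
    unfolding energy_def greens_formula[OF assms assms(2) refl]
    by (simp add: power2_eq_square mult_ac)
qed

lemma energy_nonneg: "finite A \<Longrightarrow> supported A u \<Longrightarrow> 0 \<le> energy A u"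
  by (rule order_trans[OF _ energy_ge])
    (auto intro!: sum_nonneg simp: less_imp_le[OF mu_pos] less_imp_le[OF h_pos])

lemma H_norm_eq_energy:
  assumes A: "finite A" and u: "supported A u"
  shows "H_norm E w \<mu> h u = sqrt (energy A u)"
proof -
  define B where "B = A \<union> E `` A"
  have finB: "finite B"
    using A loc_finite unfolding B_def by (metis Image_eq_UN finite_UN finite_UnI)
  have grad: "\<mu> x * (grad_norm E w \<mu> u x)\<^sup>2 = (\<Sum>y\<in>E `` {x}. w x y * ((u y - u x) * (u y - u x))) / 2"
    for x
  proof -
    have "0 \<le> (\<Sum>y\<in>E `` {x}. w x y * ((u y - u x) * (u y - u x)))"
      by (intro sum_nonneg mult_nonneg_nonneg[OF less_imp_le[OF w_pos]] zero_le_square) auto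
    then show ?thesis
      using mu_pos[of x] by (simp add: grad_norm_def power2_eq_square)
  qed
  \<comment> \<open>Off \<open>B\<close> neither \<open>x\<close> nor, by symmetry of
    \<open>E\<close>, any neighbour of \<open>x\<close> lies in \<open>A\<close>; hence the infinite
    sum reduces to \<open>B\<close>.\<close>
  have out: "\<mu> x * ((grad_norm E w \<mu> u x)\<^sup>2 + h x * (u x)\<^sup>2) = 0" if "x \<notin> B" for x
  proof -
    have "u x = 0"
      using that u by (auto simp: B_def supported_def)
    moreover have "u y = 0" if "(x, y) \<in> E" for y
      using that \<open>x \<notin> B\<close> u graph by (auto simp: B_def supported_def sym_def)
    ultimately have "(\<Sum>y\<in>E `` {x}. w x y * ((u y - u x) * (u y - u x))) = 0"
      by (intro sum.neutral) auto
    then show ?thesis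
      using \<open>u x = 0\<close> by (simp add: distrib_left grad)
  qed
  have "vint \<mu> (\<lambda>x. (grad_norm E w \<mu> u x)\<^sup>2 + h x * (u x)\<^sup>2) =
      (\<Sum>\<^sub>\<infinity>x\<in>B. \<mu> x * ((grad_norm E w \<mu> u x)\<^sup>2 + h x * (u x)\<^sup>2))"
    unfolding vint_def by (rule infsum_cong_neutral) (use out in auto)
  also have "\<dots> = (\<Sum>x\<in>B. \<mu> x * ((grad_norm E w \<mu> u x)\<^sup>2 + h x * (u x)\<^sup>2))"
    using finB by simp
  also have "\<dots> = (\<Sum>x\<in>B. \<Sum>y\<in>E `` {x}. w x y * ((u y - u x) * (u y - u x))) / 2
      + (\<Sum>x\<in>B. \<mu> x * h x * u x * u x)"
    unfolding distrib_left grad sum.distrib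
    by (simp add: sum_divide_distrib power2_eq_square mult_ac)
  also have "(\<Sum>x\<in>B. \<mu> x * h x * u x * u x) = (\<Sum>x\<in>A. \<mu> x * h x * u x * u x)"
    by (rule sum.mono_neutral_right) (use finB u in \<open>auto simp: B_def supported_def\<close>)
  finally show ?thesis
    unfolding H_norm_def energy_def greens_formula[OF A u u B_def] by simp
qed

text \<open>A single nonnegative constant serves all finite sets \<open>A\<close>; this is how
  \<open>g\<close> enters the estimates uniform in \<open>A\<close>.\<close>

lemma H_dual_bound:
  assumes "g \<in> H_dual E w \<mu> h"
  obtains C where "C \<ge> 0"
    and "\<And>A u. finite A \<Longrightarrow> supported A u \<Longrightarrow> \<bar>\<Sum>x\<in>A. \<mu> x * g x * u x\<bar> \<le> C * sqrt (energy A u)"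
proof -
  obtain C where C: "\<And>\<phi>. \<phi> \<in> Cc \<Longrightarrow> \<bar>vint \<mu> (\<lambda>x. g x * \<phi> x)\<bar> \<le> C * H_norm E w \<mu> h \<phi>"
    using assms by (auto simp: H_dual_def)
  show thesis
  proof (rule that[of "\<bar>C\<bar>"])
    fix A and u :: "'v \<Rightarrow> real" assume A: "finite A" and u: "supported A u"
    have "vint \<mu> (\<lambda>x. g x * u x) = (\<Sum>\<^sub>\<infinity>x\<in>A. \<mu> x * (g x * u x))"
      unfolding vint_def by (rule infsum_cong_neutral) (use u in \<open>auto simp: supported_def\<close>)
    also have "\<dots> = (\<Sum>x\<in>A. \<mu> x * g x * u x)"
      using A by (simp add: mult.assoc)
    finally have "\<bar>\<Sum>x\<in>A. \<mu> x * g x * u x\<bar> = \<bar>vint \<mu> (\<lambda>x. g x * u x)\<bar>"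
      by simp
    also have "\<dots> \<le> C * H_norm E w \<mu> h u"
      using A u by (intro C) (auto simp: Cc_def supported_def elim!: rev_finite_subset)
    also have "\<dots> \<le> \<bar>C\<bar> * sqrt (energy A u)"
      unfolding H_norm_eq_energy[OF A u] by (intro mult_right_mono) (auto simp: energy_nonneg A u)
    finally show "\<bar>\<Sum>x\<in>A. \<mu> x * g x * u x\<bar> \<le> \<bar>C\<bar> * sqrt (energy A u)" .
  qed simp
qed

lemma energy_add_scaleR:
  assumes "finite A" "supported A u" "supported A d"
  shows "energy A (\<lambda>x. u x + s * d x) =
    energy A u + 2 * s * (\<Sum>x\<in>A. d x * schroedinger u x) + s\<^sup>2 * energy A d"
proof -
  have "energy A (\<lambda>x. u x + s * d x) = energy A u + s * (\<Sum>x\<in>A. d x * schroedinger u x)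
     + s * (\<Sum>x\<in>A. u x * schroedinger d x) + s\<^sup>2 * energy A d"
    by (simp add: energy_def schroedinger_add_scaleR sum.distrib[symmetric] sum_distrib_left
        algebra_simps power2_eq_square)
  then show ?thesis
    using schroedinger_symmetric[OF assms(1,3,2)] by simp
qed

text \<open>A crude bound by row sums. That \<open>\<Lambda>\<close> depends on \<open>A\<close> is
  harmless: it governs the length of the descent steps, not the estimates of the solutions.\<close>

lemma energy_le_sum_squares:
  assumes A: "finite A"
  obtains \<Lambda> where "\<Lambda> \<ge> 0"
    and "\<And>d. supported A d \<Longrightarrow> energy A d \<le> \<Lambda> * (\<Sum>x\<in>A. (d x)\<^sup>2)"
proof -
  define c where "c x = (\<Sum>y\<in>E `` {x}. 2 * w x y) + \<mu> x * h x" for x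
  have c: "c x \<ge> 0" for x
    unfolding c_def using mu_pos[of x] h_pos[of x] w_pos
    by (intro add_nonneg_nonneg sum_nonneg mult_nonneg_nonneg) (auto simp: less_imp_le)
  show thesis
  proof (rule that[of "\<Sum>x\<in>A. c x"])
    show "0 \<le> (\<Sum>x\<in>A. c x)"
      by (intro sum_nonneg c)
    fix d assume d: "supported A d"
    define D where "D = sqrt (\<Sum>x\<in>A. (d x)\<^sup>2)"
    have D2: "D * D = (\<Sum>x\<in>A. (d x)\<^sup>2)"
      by (simp add: D_def sum_nonneg)
    have D: "\<bar>d x\<bar> \<le> D" for x
    proof (cases "x \<in> A")
      case True
      then have "(d x)\<^sup>2 \<le> (\<Sum>x\<in>A. (d x)\<^sup>2)"
        by (intro member_le_sum) (use A in auto)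
      then show ?thesis
        unfolding D_def by (metis real_sqrt_abs real_sqrt_le_iff)
    next
      case False
      then show ?thesis
        using d by (simp add: supported_def D_def sum_nonneg)
    qed
    then have "0 \<le> D"
      using abs_ge_zero order_trans by blast
    have "d x * schroedinger d x \<le> D * (c x * D)" for x
    proof -
      have "\<bar>schroedinger d x\<bar> \<le> (\<Sum>y\<in>E `` {x}. \<bar>w x y * (d x - d y)\<bar>) + \<bar>\<mu> x * h x * d x\<bar>"
        unfolding schroedinger_def by (intro order_trans[OF abs_triangle_ineq] add_right_mono sum_abs)
      also have "\<dots> \<le> (\<Sum>y\<in>E `` {x}. 2 * w x y * D) + \<mu> x * h x * D"
      proof (intro add_mono sum_mono)
        fix y assume "y \<in> E `` {x}"
        then have "w x y > 0" by (simp add: w_pos)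
        moreover have "\<bar>d x - d y\<bar> \<le> 2 * D"
          using D[of x] D[of y] by linarith
        ultimately have "w x y * \<bar>d x - d y\<bar> \<le> w x y * (2 * D)"
          by (intro mult_left_mono) auto
        then show "\<bar>w x y * (d x - d y)\<bar> \<le> 2 * w x y * D"
          using \<open>w x y > 0\<close> by (simp add: abs_mult)
      next
        show "\<bar>\<mu> x * h x * d x\<bar> \<le> \<mu> x * h x * D"
          using mu_pos[of x] h_pos[of x] D[of x] by (simp add: abs_mult mult_left_mono)
      qed
      also have "\<dots> = c x * D"
        by (simp add: c_def sum_distrib_right distrib_right)
      finally have "\<bar>d x * schroedinger d x\<bar> \<le> D * (c x * D)"
        unfolding abs_mult using D[of x] \<open>0 \<le> D\<close> by (intro mult_mono) auto
      then show ?thesis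
        by linarith
    qed
    then have "energy A d \<le> (\<Sum>x\<in>A. D * (c x * D))"
      unfolding energy_def by (rule sum_mono)
    also have "\<dots> = (\<Sum>x\<in>A. c x) * (D * D)"
      by (simp add: sum_distrib_left sum_distrib_right mult_ac)
    finally show "energy A d \<le> (\<Sum>x\<in>A. c x) * (\<Sum>x\<in>A. (d x)\<^sup>2)"
      by (simp add: D2)
  qed
qed

end

section \<open>Superlinear nonlinearities\<close>

lemma loc_lipschitz_isCont:
  assumes "loc_lipschitz f"
  shows "isCont (f x) a"
proof -
  have "\<bar>a\<bar> + 1 > 0" by simp
  then obtain L where "L > 0" and L: "\<And>s t. s \<in> {-(\<bar>a\<bar> + 1)..\<bar>a\<bar> + 1} \<Longrightarrow>
      t \<in> {-(\<bar>a\<bar> + 1)..\<bar>a\<bar> + 1} \<Longrightarrow> \<bar>f x s - f x t\<bar> \<le> L * \<bar>s - t\<bar>"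
    using assms unfolding loc_lipschitz_def by meson
  then have "L-lipschitz_on {-(\<bar>a\<bar> + 1)..\<bar>a\<bar> + 1} (f x)"
    by (intro lipschitz_onI) (auto simp: dist_real_def)
  then have "continuous_on {-(\<bar>a\<bar> + 1)..\<bar>a\<bar> + 1} (f x)"
    by (rule lipschitz_on_continuous_on)
  then show ?thesis
    by (rule continuous_on_interior) auto
qed

lemma loc_lipschitz_primitive_DERIV:
  assumes "loc_lipschitz f"
  shows "(primitive f x has_real_derivative f x s) (at s)"
proof -
  have "continuous_on {-(\<bar>s\<bar> + 1)..\<bar>s\<bar> + 1} (f x)"
    using loc_lipschitz_isCont[OF assms] by (intro continuous_at_imp_continuous_on) auto
  then have "((\<lambda>u. LBINT t=ereal 0..u. f x t) has_vector_derivative f x s)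
      (at s within {-(\<bar>s\<bar> + 1)..\<bar>s\<bar> + 1})"
    by (intro interval_integral_FTC2) auto
  then have "((\<lambda>u. LBINT t=ereal 0..u. f x t) has_vector_derivative f x s) (at s)"
    by (subst (asm) at_within_interior) auto
  then show ?thesis
    by (simp add: primitive_def[abs_def] has_real_derivative_iff_has_vector_derivative zero_ereal_def)
qed

locale superlinear =
  fixes f :: "'v \<Rightarrow> real \<Rightarrow> real" and \<theta> :: real
  assumes f_lipschitz: "loc_lipschitz f"
    and theta: "\<theta> > 2"
    and f_superlinear: "s > 0 \<Longrightarrow> 0 < \<theta> * primitive f x s \<and> \<theta> * primitive f x s \<le> s * f x s"
begin

lemma primitive_pos: "s > 0 \<Longrightarrow> primitive f x s > 0"
  using f_superlinear[of s x] theta by (simp add: zero_less_mult_iff)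

text \<open>As \<open>s\<close> decreases to 0, both \<open>primitive f x s / s\<close> and
  \<open>f x s\<close> tend to \<open>f x 0\<close>. Positivity gives \<open>0 \<le> f x 0\<close>,
  superlinearity gives \<open>\<theta> * f x 0 \<le> f x 0\<close>, and
  \<open>\<theta> > 1\<close>.\<close>

lemma f_zero: "f x 0 = 0"
proof -
  have prim0: "primitive f x 0 = 0"
    by (simp add: primitive_def zero_ereal_def[symmetric])
  have "((\<lambda>s. primitive f x s / s) \<longlongrightarrow> f x 0) (at 0)"
    using loc_lipschitz_primitive_DERIV[OF f_lipschitz, of x 0] by (simp add: DERIV_def prim0)
  then have lim: "((\<lambda>s. primitive f x s / s) \<longlongrightarrow> f x 0) (at_right 0)"
    by (rule tendsto_within_subset) auto
  have limf: "(f x \<longlongrightarrow> f x 0) (at_right 0)"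
    using loc_lipschitz_isCont[OF f_lipschitz] by (simp add: isCont_def filterlim_at_split)
  have "0 \<le> f x 0"
    using lim by (rule tendsto_lowerbound)
      (auto simp: eventually_at_right_less primitive_pos less_imp_le intro!: eventually_at_rightI[of 0 1])
  moreover have "\<theta> * f x 0 \<le> f x 0"
    using limf tendsto_mult_left[OF lim, of \<theta>]
  proof (rule tendsto_le[rotated])
    show "\<forall>\<^sub>F s in at_right 0. \<theta> * (primitive f x s / s) \<le> f x s"
      using f_superlinear by (intro eventually_at_rightI[of 0 1]) (auto simp: field_simps)
  qed auto
  then have "(\<theta> - 1) * f x 0 \<le> 0"
    by (simp add: algebra_simps)
  ultimately show ?thesis
    using theta by (simp add: mult_le_0_iff)
qed

text \<open>Truncating the nonlinearity at negative arguments makes every solution nonnegative.\<close>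

definition trunc :: "'v \<Rightarrow> real \<Rightarrow> real" where
  "trunc x s = f x (max 0 s)"

lemma trunc_lipschitz:
  obtains L where "L > 0" and "\<And>x s t. \<bar>s\<bar> \<le> M \<Longrightarrow> \<bar>t\<bar> \<le> M \<Longrightarrow> \<bar>trunc x s - trunc x t\<bar> \<le> L * \<bar>s - t\<bar>"
proof -
  \<comment> \<open>\<open>M\<close> may be nonpositive, while \<open>loc_lipschitz\<close> provides
    constants for positive radii.\<close>
  obtain L where "L > 0" and L: "\<And>s t x. s \<in> {-max 1 M..max 1 M} \<Longrightarrow>
      t \<in> {-max 1 M..max 1 M} \<Longrightarrow> \<bar>f x s - f x t\<bar> \<le> L * \<bar>s - t\<bar>"
    using f_lipschitz unfolding loc_lipschitz_def by (metis less_max_iff_disj zero_less_one)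
  show thesis
  proof (rule that[OF \<open>L > 0\<close>])
    fix x s t assume "\<bar>s\<bar> \<le> M" "\<bar>t\<bar> \<le> M"
    then have "\<bar>trunc x s - trunc x t\<bar> \<le> L * \<bar>max 0 s - max 0 t\<bar>"
      unfolding trunc_def by (intro L) auto
    also have "\<dots> \<le> L * \<bar>s - t\<bar>"
      using \<open>L > 0\<close> by (intro mult_left_mono) auto
    finally show "\<bar>trunc x s - trunc x t\<bar> \<le> L * \<bar>s - t\<bar>" .
  qed
qed

lemma loc_lipschitz_trunc: "loc_lipschitz trunc"
  unfolding loc_lipschitz_def
proof (intro allI impI)
  fix M :: real
  obtain L where "L > 0" and "\<And>x s t. \<bar>s\<bar> \<le> M \<Longrightarrow> \<bar>t\<bar> \<le> M \<Longrightarrow> \<bar>trunc x s - trunc x t\<bar> \<le> L * \<bar>s - t\<bar>"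
    using trunc_lipschitz[of M] by blast
  then show "\<exists>L>0. \<forall>s\<in>{-M..M}. \<forall>t\<in>{-M..M}. \<forall>x. \<bar>trunc x s - trunc x t\<bar> \<le> L * \<bar>s - t\<bar>"
    by (intro exI[of _ L]) (auto simp: abs_le_iff)
qed

lemmas trunc_isCont = loc_lipschitz_isCont[OF loc_lipschitz_trunc]
lemmas primitive_trunc_DERIV = loc_lipschitz_primitive_DERIV[OF loc_lipschitz_trunc]

lemma trunc_zero: "s \<le> 0 \<Longrightarrow> trunc x s = 0"
  by (simp add: trunc_def f_zero max_def)

lemma primitive_trunc_pos: "s \<ge> 0 \<Longrightarrow> primitive trunc x s = primitive f x s"
  unfolding primitive_def
  by (rule interval_integral_cong) (auto simp: trunc_def max_def einterval_def zero_ereal_def)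

lemma primitive_trunc_neg:
  assumes "s \<le> 0"
  shows "primitive trunc x s = 0"
proof -
  have "primitive trunc x s = (LBINT t=0..s. 0)"
    unfolding primitive_def
    by (rule interval_integral_cong)
      (use assms in \<open>auto simp: einterval_def zero_ereal_def max_def min_def split: if_splits intro!: trunc_zero\<close>)
  then show ?thesis by simp
qed

lemma primitive_trunc_nonneg: "0 \<le> primitive trunc x s"
  using primitive_pos[of s x] primitive_trunc_pos[of s x] primitive_trunc_neg[of s x]
  by (cases "s > 0") auto

lemma trunc_nonneg: "0 \<le> trunc x s"
proof (cases "s > 0")
  case True
  then have "0 < s * f x s"
    using f_superlinear[of s x] by linarith
  then show ?thesis
    using True by (simp add: trunc_def zero_less_mult_iff max_def)
qed (simp add: trunc_zero)

lemma trunc_superlinear: "\<theta> * primitive trunc x s \<le> s * trunc x s"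
  using f_superlinear[of s x] primitive_trunc_pos[of s x] primitive_trunc_neg[of s x] trunc_zero[of s x]
  by (cases "s > 0") (auto simp: trunc_def max_def)

section \<open>Growth of the primitive at zero and at infinity\<close>

text \<open>The Ambrosetti-Rabinowitz inequality is exactly the nonnegativity of the derivative of
  \<open>primitive f x s * s powr - \<theta>\<close>.\<close>

lemma primitive_growth:
  assumes "0 < s" "s \<le> t"
  shows "primitive f x s * s powr - \<theta> \<le> primitive f x t * t powr - \<theta>"
proof (rule DERIV_nonneg_imp_nondecreasing[OF assms(2)])
  fix a assume "s \<le> a" "a \<le> t"
  then have a: "a > 0" using assms by linarith
  have "((\<lambda>s. primitive f x s * s powr - \<theta>) has_real_derivative
      f x a * a powr - \<theta> + (- \<theta> * a powr (- \<theta> - 1)) * primitive f x a) (at a)"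
    using a by (intro DERIV_mult loc_lipschitz_primitive_DERIV[OF f_lipschitz]) (auto intro!: derivative_eq_intros)
  moreover have "f x a * a powr - \<theta> + (- \<theta> * a powr (- \<theta> - 1)) * primitive f x a =
      (a * f x a - \<theta> * primitive f x a) * a powr (- \<theta> - 1)"
    using a by (simp add: algebra_simps powr_diff)
  moreover have "\<dots> \<ge> 0"
    using f_superlinear[OF a, of x] by simp
  ultimately show "\<exists>y. ((\<lambda>s. primitive f x s * s powr - \<theta>) has_real_derivative y) (at a) \<and> 0 \<le> y"
    by auto
qed

text \<open>For \<open>0 < s \<le> 1\<close>, comparison with 1 gives
  \<open>primitive f x s \<le> L * s powr \<theta>\<close> with \<open>L\<close> independent of
  \<open>x\<close>; as \<open>\<theta> > 2\<close>, this is small against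
  \<open>s\<^sup>2\<close>.\<close>

lemma primitive_trunc_small:
  assumes "\<kappa> > 0"
  obtains \<eta> where "\<eta> > 0" and "\<And>x s. \<bar>s\<bar> \<le> \<eta> \<Longrightarrow> primitive trunc x s \<le> \<kappa> * s\<^sup>2"
proof -
  obtain L where "L > 0" and L: "\<And>x s t. \<bar>s\<bar> \<le> 1 \<Longrightarrow> \<bar>t\<bar> \<le> 1 \<Longrightarrow> \<bar>trunc x s - trunc x t\<bar> \<le> L * \<bar>s - t\<bar>"
    using trunc_lipschitz[of 1] by blast
  have F1: "primitive f x 1 \<le> L" for x
  proof -
    have "primitive f x 1 \<le> \<theta> * primitive f x 1"
      using primitive_pos[of 1 x] theta by simp
    also have "\<dots> \<le> f x 1"
      using f_superlinear[of 1 x] by simp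
    also have "\<dots> \<le> L"
      using L[of 1 0 x] by (simp add: trunc_def f_zero)
    finally show ?thesis .
  qed
  \<comment> \<open>The power solves \<open>L * s powr (\<theta> - 2) = \<kappa>\<close>; the bound
    1 allows the comparison with \<open>primitive f x 1\<close>.\<close>
  define \<eta> where "\<eta> = min 1 ((\<kappa> / L) powr (1 / (\<theta> - 2)))"
  have "\<eta> > 0"
    using assms \<open>L > 0\<close> by (simp add: \<eta>_def)
  moreover have "primitive trunc x s \<le> \<kappa> * s\<^sup>2" if s: "\<bar>s\<bar> \<le> \<eta>" for x s
  proof (cases "s > 0")
    case False
    then show ?thesis
      using assms by (simp add: primitive_trunc_neg)
  next
    case True
    then have "s \<le> 1" "s \<le> (\<kappa> / L) powr (1 / (\<theta> - 2))"
      using s by (auto simp: \<eta>_def)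
    then have "s powr (\<theta> - 2) \<le> ((\<kappa> / L) powr (1 / (\<theta> - 2))) powr (\<theta> - 2)"
      using True theta by (intro powr_mono2) auto
    also have "\<dots> = \<kappa> / L"
      using theta assms \<open>L > 0\<close> by (simp add: powr_powr)
    finally have small: "L * s powr (\<theta> - 2) \<le> \<kappa>"
      using \<open>L > 0\<close> by (simp add: field_simps)
    have "primitive f x s * s powr - \<theta> \<le> L"
      using primitive_growth[OF True \<open>s \<le> 1\<close>, of x] F1[of x] by simp
    then have "primitive f x s * s powr - \<theta> * s powr \<theta> \<le> L * s powr \<theta>"
      by (intro mult_right_mono) auto
    then have "primitive f x s \<le> L * s powr ((\<theta> - 2) + 2)"
      using True by (simp add: mult.assoc powr_add[symmetric])
    also have "\<dots> = L * s powr (\<theta> - 2) * s\<^sup>2"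
      using True by (simp only: powr_add) simp
    also have "\<dots> \<le> \<kappa> * s\<^sup>2"
      using small by (intro mult_right_mono) auto
    finally show ?thesis
      using True by (simp add: primitive_trunc_pos)
  qed
  ultimately show thesis
    using that by blast
qed

lemma primitive_trunc_superquadratic:
  obtains s where "s \<ge> s0" and "s > 0" and "primitive trunc x s \<ge> C * s\<^sup>2"
proof -
  define c where "c = primitive f x 1"
  have "c > 0"
    by (simp add: c_def primitive_pos)
  \<comment> \<open>The power solves \<open>c * s powr (\<theta> - 2) = \<bar>C\<bar>\<close>; the
    entry 1 allows the use of \<open>primitive_growth\<close> from 1 to \<open>s\<close>.\<close>
  define s where "s = Max {1, s0, (\<bar>C\<bar> / c) powr (1 / (\<theta> - 2))}"
  have s: "s \<ge> 1" "s \<ge> s0" "(\<bar>C\<bar> / c) powr (1 / (\<theta> - 2)) \<le> s"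
    by (auto simp: s_def)
  have "\<bar>C\<bar> / c = ((\<bar>C\<bar> / c) powr (1 / (\<theta> - 2))) powr (\<theta> - 2)"
    using theta \<open>c > 0\<close> by (simp add: powr_powr)
  also have "\<dots> \<le> s powr (\<theta> - 2)"
    using s theta by (intro powr_mono2) auto
  finally have "\<bar>C\<bar> \<le> c * s powr (\<theta> - 2)"
    using \<open>c > 0\<close> by (simp add: field_simps)
  then have "C * s\<^sup>2 \<le> c * s powr (\<theta> - 2) * s\<^sup>2"
    by (intro mult_right_mono) auto
  also have "\<dots> = c * s powr ((\<theta> - 2) + 2)"
    using s by (simp only: powr_add) simp
  also have "\<dots> \<le> primitive f x s * s powr - \<theta> * s powr \<theta>"
    using primitive_growth[of 1 s x] s by (simp add: c_def mult_right_mono)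
  also have "\<dots> = primitive trunc x s"
    using s by (simp add: mult.assoc powr_add[symmetric] primitive_trunc_pos)
  finally show thesis
    using that[of s] s by simp
qed

text \<open>Second-order expansion from below: by the mean value theorem the increment is
  \<open>b * trunc x z\<close>, and \<open>trunc x z\<close> differs from \<open>trunc x a\<close>
  by at most \<open>L * \<bar>b\<bar>\<close>.\<close>

lemma primitive_trunc_step:
  assumes L: "\<And>s t. \<bar>s\<bar> \<le> M \<Longrightarrow> \<bar>t\<bar> \<le> M \<Longrightarrow> \<bar>trunc x s - trunc x t\<bar> \<le> L * \<bar>s - t\<bar>" and "L \<ge> 0"
    and "\<bar>a\<bar> \<le> M" "\<bar>a + b\<bar> \<le> M"
  shows "primitive trunc x (a + b) \<ge> primitive trunc x a + trunc x a * b - L * b\<^sup>2"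
proof (cases "b = 0")
  case False
  obtain z where z: "min a (a + b) < z" "z < max a (a + b)"
    and eq: "primitive trunc x (a + b) - primitive trunc x a = b * trunc x z"
  proof (cases "b > 0")
    case True
    then obtain z where "z > a" "z < a + b"
      "primitive trunc x (a + b) - primitive trunc x a = (a + b - a) * trunc x z"
      using MVT2[of a "a + b" "primitive trunc x" "trunc x"] primitive_trunc_DERIV by fastforce
    then show ?thesis
      using that[of z] True by simp
  next
    case neg: False
    then have "a + b < a"
      using False by linarith
    then obtain z where "z > a + b" "z < a"
      "primitive trunc x a - primitive trunc x (a + b) = (a - (a + b)) * trunc x z"
      using MVT2[of "a + b" a "primitive trunc x" "trunc x"] primitive_trunc_DERIV by fastforce
    then show ?thesis
      using that[of z] neg by simp
  qed
  have "\<bar>b * (trunc x z - trunc x a)\<bar> \<le> \<bar>b\<bar> * (L * \<bar>z - a\<bar>)"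
    unfolding abs_mult using z assms(3,4) by (intro mult_left_mono L) (auto simp: min_def max_def split: if_splits)
  also have "\<dots> \<le> \<bar>b\<bar> * (L * \<bar>b\<bar>)"
    using z \<open>L \<ge> 0\<close> by (intro mult_left_mono) (auto simp: min_def max_def split: if_splits)
  also have "\<dots> = L * b\<^sup>2"
    by (simp add: power2_eq_square)
  finally show ?thesis
    using eq by (simp add: algebra_simps)
qed simp

end

section \<open>Steepest descent on a finite vertex set\<close>

text \<open>Supplies a step length that depends continuously on the size of the current point;
  limits of orbits and their dependence on the starting point are controlled through this
  continuity. The choice is half the distance from \<open>(M, 0)\<close> to the pairs that
  fail.\<close>

lemma continuous_positive_selection:
  fixes P :: "real \<Rightarrow> real \<Rightarrow> bool"
  assumes ex: "\<And>M. \<exists>\<tau>>0. P M \<tau>"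
    and mono: "\<And>M \<tau> M' \<tau>'. P M \<tau> \<Longrightarrow> M' \<le> M \<Longrightarrow> \<tau>' \<le> \<tau> \<Longrightarrow> P M' \<tau>'"
  obtains T where "continuous_on UNIV T" "\<And>M. T M > 0" "\<And>M. P M (T M)"
proof -
  \<comment> \<open>The clause \<open>\<tau> < 1\<close> makes \<open>N\<close> nonempty, so that
    \<open>infdist\<close> is a genuine infimum and not the default value 0.\<close>
  define N where "N = {(M, \<tau>). \<not> (P M \<tau> \<and> \<tau> < 1)}"
  have ne: "N \<noteq> {}"
    by (auto simp: N_def intro!: exI[of _ 1])
  define T where "T M = infdist (M, 0) N / 2" for M
  have pos: "T M > 0" for M
  proof -
    obtain \<tau> where \<tau>: "\<tau> > 0" "P (M + 1) \<tau>"
      using ex by blast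
    \<comment> \<open>A pair close to \<open>(M, 0)\<close> lies below
      \<open>(M + 1, \<tau>)\<close> in both coordinates, so monotonicity makes it
      admissible.\<close>
    have "min 1 \<tau> \<le> dist (M, 0) p" if "p \<in> N" for p
    proof (rule ccontr)
      assume "\<not> min 1 \<tau> \<le> dist (M, 0) p"
      then have "\<bar>M - fst p\<bar> < 1" "\<bar>snd p\<bar> < \<tau>" "\<bar>snd p\<bar> < 1"
        using dist_fst_le[of "(M, 0)" p] dist_snd_le[of "(M, 0)" p] by (auto simp: dist_real_def)
      then have "P (fst p) (snd p)"
        by (intro mono[OF \<tau>(2)]) auto
      then show False
        using that \<open>\<bar>snd p\<bar> < 1\<close> by (auto simp: N_def)
    qed
    then have "min 1 \<tau> \<le> infdist (M, 0) N"
      unfolding infdist_notempty[OF ne] by (intro cINF_greatest ne)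
    then show ?thesis
      using \<tau>(1) by (simp add: T_def min_def split: if_splits)
  qed
  moreover have "continuous_on UNIV T"
    unfolding T_def by (intro continuous_intros) auto
  moreover have "P M (T M)" for M
  proof (rule ccontr)
    assume "\<not> P M (T M)"
    then have "(M, T M) \<in> N"
      by (simp add: N_def)
    from infdist_le[OF this, of "(M, 0)"] have "infdist (M, 0) N \<le> T M"
      using pos[of M] by (simp add: dist_Pair_Pair)
    then show False
      using pos[of M] by (simp add: T_def)
  qed
  ultimately show thesis
    using that by blast
qed

locale perturbed_problem = weighted_graph E w \<mu> h \<mu>_min h0 + superlinear f \<theta>
  for E :: "('v \<times> 'v) set" and w :: "'v \<Rightarrow> 'v \<Rightarrow> real" and \<mu> h :: "'v \<Rightarrow> real"
    and \<mu>_min h0 :: real and f :: "'v \<Rightarrow> real \<Rightarrow> real" and \<theta> :: real +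
  fixes g :: "'v \<Rightarrow> real" and C \<epsilon> :: real
  assumes C_nonneg: "C \<ge> 0"
    and g_bound: "finite A \<Longrightarrow> supported A u \<Longrightarrow> \<bar>\<Sum>x\<in>A. \<mu> x * g x * u x\<bar> \<le> C * sqrt (energy A u)"
    and g_nonneg: "g x \<ge> 0"
    and eps_nonneg: "\<epsilon> \<ge> 0"
begin

section \<open>The functional, its gradient and descent steps\<close>

definition J :: "'v set \<Rightarrow> ('v \<Rightarrow> real) \<Rightarrow> real" where
  "J A u = energy A u / 2 - (\<Sum>x\<in>A. \<mu> x * primitive trunc x (u x)) - \<epsilon> * (\<Sum>x\<in>A. \<mu> x * g x * u x)"

text \<open>The partial derivatives of \<open>J A\<close> at the vertices of \<open>A\<close>, on
  functions supported in \<open>A\<close>. It vanishes at every vertex exactly when \<open>u\<close>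
  solves the equation with truncated nonlinearity.\<close>

definition residual :: "('v \<Rightarrow> real) \<Rightarrow> 'v \<Rightarrow> real" where
  "residual u x = schroedinger u x - \<mu> x * trunc x (u x) - \<epsilon> * \<mu> x * g x"

definition residual2 :: "'v set \<Rightarrow> ('v \<Rightarrow> real) \<Rightarrow> real" where
  "residual2 A u = (\<Sum>x\<in>A. (residual u x)\<^sup>2)"

text \<open>The quadratic form and the term with \<open>g\<close> expand exactly;
  \<open>primitive_trunc_step\<close> controls the nonlinear term as long as both end points have
  values within \<open>M\<close>.\<close>

lemma J_step:
  assumes A: "finite A" and u: "supported A u" and d: "supported A d"
    and \<Lambda>: "energy A d \<le> \<Lambda> * (\<Sum>x\<in>A. (d x)\<^sup>2)"
    and L: "\<And>x s t. \<bar>s\<bar> \<le> M \<Longrightarrow> \<bar>t\<bar> \<le> M \<Longrightarrow> \<bar>trunc x s - trunc x t\<bar> \<le> L * \<bar>s - t\<bar>" and "L \<ge> 0"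
    and M: "\<And>x. x \<in> A \<Longrightarrow> \<bar>u x\<bar> \<le> M" "\<And>x. x \<in> A \<Longrightarrow> \<bar>u x + s * d x\<bar> \<le> M"
  shows "J A (\<lambda>x. u x + s * d x) \<le> J A u + s * (\<Sum>x\<in>A. d x * residual u x)
    + s\<^sup>2 * ((\<Lambda> / 2 + L * (\<Sum>x\<in>A. \<mu> x)) * (\<Sum>x\<in>A. (d x)\<^sup>2))"
proof -
  define D where "D = (\<Sum>x\<in>A. (d x)\<^sup>2)"
  define Q where "Q = (\<Sum>x\<in>A. d x * schroedinger u x)"
  define N where "N = (\<Sum>x\<in>A. d x * (\<mu> x * trunc x (u x)))"
  define G where "G = (\<Sum>x\<in>A. \<mu> x * g x * d x)"
  have "(\<Sum>x\<in>A. \<mu> x * primitive trunc x (u x + s * d x)) \<ge>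
      (\<Sum>x\<in>A. \<mu> x * (primitive trunc x (u x) + trunc x (u x) * (s * d x) - L * (s * d x)\<^sup>2))"
    using M \<open>L \<ge> 0\<close>
    by (intro sum_mono mult_left_mono primitive_trunc_step[of M] L) (auto simp: less_imp_le[OF mu_pos])
  moreover have "(\<Sum>x\<in>A. \<mu> x * (primitive trunc x (u x) + trunc x (u x) * (s * d x) - L * (s * d x)\<^sup>2))
      = (\<Sum>x\<in>A. \<mu> x * primitive trunc x (u x)) + s * N - L * s\<^sup>2 * (\<Sum>x\<in>A. \<mu> x * (d x)\<^sup>2)"
    by (simp add: N_def algebra_simps sum.distrib sum_subtractf sum_distrib_left power_mult_distrib)
  moreover have "(\<Sum>x\<in>A. \<mu> x * (d x)\<^sup>2) \<le> (\<Sum>x\<in>A. (\<Sum>x\<in>A. \<mu> x) * (d x)\<^sup>2)"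
    by (intro sum_mono mult_right_mono member_le_sum) (auto simp: A less_imp_le[OF mu_pos])
  then have "L * s\<^sup>2 * (\<Sum>x\<in>A. \<mu> x * (d x)\<^sup>2) \<le> L * s\<^sup>2 * ((\<Sum>x\<in>A. \<mu> x) * D)"
    using \<open>L \<ge> 0\<close> by (intro mult_left_mono) (auto simp: D_def sum_distrib_left)
  moreover have "s\<^sup>2 * energy A d \<le> s\<^sup>2 * (\<Lambda> * D)"
    using \<Lambda> unfolding D_def by (rule mult_left_mono) simp
  moreover have "(\<Sum>x\<in>A. d x * residual u x) = Q - N - \<epsilon> * G"
    by (simp add: Q_def N_def G_def residual_def algebra_simps sum.distrib sum_subtractf sum_distrib_left)
  then have "s * (\<Sum>x\<in>A. d x * residual u x) = s * Q - s * N - s * (\<epsilon> * G)"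
    by (simp only: right_diff_distrib)
  moreover have "\<epsilon> * (\<Sum>x\<in>A. \<mu> x * g x * (u x + s * d x)) =
      \<epsilon> * (\<Sum>x\<in>A. \<mu> x * g x * u x) + s * (\<epsilon> * G)"
    by (simp add: G_def algebra_simps sum.distrib sum_distrib_left)
  moreover have "s\<^sup>2 * ((\<Lambda> / 2 + L * (\<Sum>x\<in>A. \<mu> x)) * D) =
      s\<^sup>2 * (\<Lambda> * D) / 2 + L * s\<^sup>2 * ((\<Sum>x\<in>A. \<mu> x) * D)"
    by (simp add: algebra_simps)
  moreover have "2 * s * Q = 2 * (s * Q)"
    by simp
  ultimately show ?thesis
    unfolding J_def energy_add_scaleR[OF A u d] D_def[symmetric] Q_def[symmetric] by argo
qed

definition steepest :: "'v set \<Rightarrow> ('v \<Rightarrow> real) \<Rightarrow> 'v \<Rightarrow> real" where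
  "steepest A u x = (if x \<in> A then - residual u x else 0)"

text \<open>Chosen so that a step of length at most 1 leaves all values within this bound, where one
  Lipschitz constant applies.\<close>

definition magnitude :: "'v set \<Rightarrow> ('v \<Rightarrow> real) \<Rightarrow> real" where
  "magnitude A u = (\<Sum>x\<in>A. \<bar>u x\<bar> + \<bar>residual u x\<bar>)"

lemma supported_steepest: "supported A (steepest A u)"
  by (simp add: supported_def steepest_def)

text \<open>The first-order decrease is \<open>s * residual2 A u\<close>; for short steps the
  quadratic error consumes at most half of it. The admissible length depends on \<open>u\<close>
  through its magnitude alone.\<close>

lemma admissible_step_exists:
  assumes A: "finite A"
  shows "\<exists>\<tau>>0. \<forall>u s. supported A u \<longrightarrow> magnitude A u \<le> M \<longrightarrow> 0 \<le> s \<longrightarrow> s \<le> \<tau> \<longrightarrow>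
    J A (\<lambda>x. u x + s * steepest A u x) \<le> J A u - s / 2 * residual2 A u"
proof -
  obtain \<Lambda> where "\<Lambda> \<ge> 0" and \<Lambda>: "\<And>d. supported A d \<Longrightarrow> energy A d \<le> \<Lambda> * (\<Sum>x\<in>A. (d x)\<^sup>2)"
    using energy_le_sum_squares[OF A] by blast
  obtain L where "L > 0" and L: "\<And>x s t. \<bar>s\<bar> \<le> M \<Longrightarrow> \<bar>t\<bar> \<le> M \<Longrightarrow> \<bar>trunc x s - trunc x t\<bar> \<le> L * \<bar>s - t\<bar>"
    using trunc_lipschitz[of M] by blast
  define k where "k = \<Lambda> / 2 + L * (\<Sum>x\<in>A. \<mu> x)"
  have "k \<ge> 0"
    unfolding k_def using \<open>\<Lambda> \<ge> 0\<close> \<open>L > 0\<close>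
    by (intro add_nonneg_nonneg mult_nonneg_nonneg sum_nonneg) (auto simp: less_imp_le[OF mu_pos])
  \<comment> \<open>The bound 1 keeps the values within \<open>M\<close>, the other one gives
    \<open>s * k \<le> 1 / 2\<close>; the added 1 keeps the denominator positive for
    \<open>k = 0\<close>.\<close>
  define \<tau> where "\<tau> = min 1 (1 / (2 * k + 1))"
  show ?thesis
  proof (intro exI[of _ \<tau>] conjI allI impI)
    show "\<tau> > 0"
      using \<open>k \<ge> 0\<close> by (simp add: \<tau>_def)
    fix u s assume u: "supported A u" and M: "magnitude A u \<le> M" and s: "0 \<le> s" "s \<le> \<tau>"
    have le: "\<bar>u x\<bar> + \<bar>residual u x\<bar> \<le> M" if "x \<in> A" for x
    proof -
      have "\<bar>u x\<bar> + \<bar>residual u x\<bar> \<le> magnitude A u"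
        unfolding magnitude_def using that A by (intro member_le_sum) auto
      then show ?thesis using M by linarith
    qed
    have "s \<le> 1" "s \<le> 1 / (2 * k + 1)"
      using s by (auto simp: \<tau>_def)
    then have sk: "s * (2 * k + 1) \<le> 1"
      using \<open>k \<ge> 0\<close> by (simp add: field_simps)
    have "J A (\<lambda>x. u x + s * steepest A u x) \<le> J A u + s * (\<Sum>x\<in>A. steepest A u x * residual u x)
        + s\<^sup>2 * (k * (\<Sum>x\<in>A. (steepest A u x)\<^sup>2))"
      unfolding k_def
    proof (rule J_step[OF A u supported_steepest \<Lambda>[OF supported_steepest] L])
      fix x assume "x \<in> A"
      have "s * \<bar>residual u x\<bar> \<le> 1 * \<bar>residual u x\<bar>"
        using \<open>s \<le> 1\<close> by (intro mult_right_mono) auto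
      then have "\<bar>s * residual u x\<bar> \<le> \<bar>residual u x\<bar>"
        using s by (simp add: abs_mult)
      then show "\<bar>u x\<bar> \<le> M" "\<bar>u x + s * steepest A u x\<bar> \<le> M"
        using le[OF \<open>x \<in> A\<close>] \<open>x \<in> A\<close> by (auto simp: steepest_def)
    qed (use \<open>L > 0\<close> in auto)
    also have "(\<Sum>x\<in>A. steepest A u x * residual u x) = - residual2 A u"
      by (simp add: steepest_def residual2_def sum_negf power2_eq_square)
    also have "(\<Sum>x\<in>A. (steepest A u x)\<^sup>2) = residual2 A u"
      by (simp add: steepest_def residual2_def)
    also have "s\<^sup>2 * (k * residual2 A u) \<le> s / 2 * residual2 A u"
    proof -
      have "s * (s * (2 * k + 1)) \<le> s * 1"
        using sk s by (intro mult_left_mono) auto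
      then have "2 * (s\<^sup>2 * k) + s\<^sup>2 \<le> s"
        by (simp add: power2_eq_square algebra_simps)
      then have "s\<^sup>2 * k \<le> s / 2"
        using zero_le_power2[of s] by linarith
      then have "s\<^sup>2 * k * residual2 A u \<le> s / 2 * residual2 A u"
        by (rule mult_right_mono) (simp add: residual2_def sum_nonneg)
      then show ?thesis by (simp add: mult.assoc)
    qed
    finally show "J A (\<lambda>x. u x + s * steepest A u x) \<le> J A u - s / 2 * residual2 A u"
      by (simp add: algebra_simps)
  qed
qed

section \<open>Continuity under pointwise convergence\<close>

lemma tendsto_schroedinger:
  assumes "\<And>x. ((\<lambda>n. U n x) \<longlongrightarrow> v x) F"
  shows "((\<lambda>n. schroedinger (U n) x) \<longlongrightarrow> schroedinger v x) F"
  unfolding schroedinger_def by (intro tendsto_intros assms)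

lemma tendsto_energy:
  assumes "\<And>x. ((\<lambda>n. U n x) \<longlongrightarrow> v x) F"
  shows "((\<lambda>n. energy A (U n)) \<longlongrightarrow> energy A v) F"
  unfolding energy_def by (intro tendsto_intros tendsto_schroedinger assms)

lemma tendsto_residual:
  assumes "\<And>x. ((\<lambda>n. U n x) \<longlongrightarrow> v x) F"
  shows "((\<lambda>n. residual (U n) x) \<longlongrightarrow> residual v x) F"
  unfolding residual_def
  by (intro tendsto_intros tendsto_schroedinger isCont_tendsto_compose[OF trunc_isCont] assms)

lemma tendsto_residual2:
  assumes "\<And>x. ((\<lambda>n. U n x) \<longlongrightarrow> v x) F"
  shows "((\<lambda>n. residual2 A (U n)) \<longlongrightarrow> residual2 A v) F"
  unfolding residual2_def by (intro tendsto_intros tendsto_residual assms)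

lemma tendsto_steepest:
  assumes "\<And>x. ((\<lambda>n. U n x) \<longlongrightarrow> v x) F"
  shows "((\<lambda>n. steepest A (U n) x) \<longlongrightarrow> steepest A v x) F"
  unfolding steepest_def by (auto intro!: tendsto_intros tendsto_residual assms)

lemma tendsto_J:
  assumes "\<And>x. ((\<lambda>n. U n x) \<longlongrightarrow> v x) F"
  shows "((\<lambda>n. J A (U n)) \<longlongrightarrow> J A v) F"
  unfolding J_def
  by (intro tendsto_intros tendsto_energy isCont_tendsto_compose[OF DERIV_isCont[OF primitive_trunc_DERIV]] assms)
    simp

lemma tendsto_magnitude:
  assumes "\<And>x. ((\<lambda>n. U n x) \<longlongrightarrow> v x) F"
  shows "((\<lambda>n. magnitude A (U n)) \<longlongrightarrow> magnitude A v) F"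
  unfolding magnitude_def by (intro tendsto_intros tendsto_residual assms)

end

section \<open>The discrete descent flow\<close>

locale steepest_descent = perturbed_problem E w \<mu> h \<mu>_min h0 f \<theta> g C \<epsilon>
  for E :: "('v \<times> 'v) set" and w \<mu> h \<mu>_min h0 f \<theta> g C \<epsilon> +
  fixes A :: "'v set" and T :: "real \<Rightarrow> real"
  assumes A: "finite A"
    and T_cont: "continuous_on UNIV T"
    and T_pos: "T M > 0"
    and T_admissible: "supported A u \<Longrightarrow> 0 \<le> s \<Longrightarrow> s \<le> T (magnitude A u) \<Longrightarrow>
      J A (\<lambda>x. u x + s * steepest A u x) \<le> J A u - s / 2 * residual2 A u"
begin

definition \<tau> :: "('v \<Rightarrow> real) \<Rightarrow> real" where
  "\<tau> u = T (magnitude A u)"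

definition step :: "('v \<Rightarrow> real) \<Rightarrow> 'v \<Rightarrow> real" where
  "step u x = u x + \<tau> u * steepest A u x"

lemma supported_step: "supported A u \<Longrightarrow> supported A (step u)"
  by (simp add: supported_def step_def steepest_def)

lemma supported_orbit: "supported A u \<Longrightarrow> supported A ((step ^^ k) u)"
  by (induction k) (auto simp: supported_step)

lemma tendsto_\<tau>:
  assumes "\<And>x. ((\<lambda>n. U n x) \<longlongrightarrow> v x) F"
  shows "((\<lambda>n. \<tau> (U n)) \<longlongrightarrow> \<tau> v) F"
  unfolding \<tau>_def
  using T_cont by (intro isCont_tendsto_compose[of _ T] tendsto_magnitude assms)
    (auto simp: continuous_on_eq_continuous_at)

lemma tendsto_orbit:
  assumes "\<And>x. ((\<lambda>n. U n x) \<longlongrightarrow> v x) F"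
  shows "((\<lambda>n. (step ^^ k) (U n) x) \<longlongrightarrow> (step ^^ k) v x) F"
proof (induction k arbitrary: x)
  case (Suc k)
  then show ?case
    by (auto simp: step_def intro!: tendsto_intros tendsto_\<tau> tendsto_steepest)
qed (simp add: assms)

lemma residual2_nonneg: "0 \<le> residual2 A u"
  by (simp add: residual2_def sum_nonneg)

text \<open>Each point of the segment is itself reached by a step of the admissible length
  \<open>s * \<tau> u\<close>.\<close>

lemma J_segment:
  assumes "supported A u" "0 \<le> s" "s \<le> 1"
  shows "J A (\<lambda>x. u x + s * (step u x - u x)) \<le> J A u"
proof -
  have "J A (\<lambda>x. u x + (s * \<tau> u) * steepest A u x) \<le> J A u - (s * \<tau> u) / 2 * residual2 A u"
    using assms T_pos[of "magnitude A u"]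
    by (intro T_admissible) (auto simp: \<tau>_def mult_left_le_one_le)
  also have "\<dots> \<le> J A u"
    using assms T_pos[of "magnitude A u"] residual2_nonneg[of u] by (auto simp: \<tau>_def)
  finally show ?thesis
    by (simp add: step_def mult.assoc)
qed

lemma J_step_decrease:
  assumes "supported A u"
  shows "J A (step u) \<le> J A u - \<tau> u / 2 * residual2 A u"
  using T_admissible[OF assms, of "\<tau> u"] T_pos[of "magnitude A u"]
  by (simp add: \<tau>_def step_def[abs_def] less_imp_le)

lemma J_step_le: "supported A u \<Longrightarrow> J A (step u) \<le> J A u"
  using J_segment[of u 1] by simp

lemma J_orbit_le: "supported A u \<Longrightarrow> J A ((step ^^ k) u) \<le> J A u"
  by (induction k) (auto intro: order_trans[OF J_step_le] supported_orbit)

text \<open>If the residual stayed away from zero, the orbit would have finite length, and its limit would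
  be a point of nonzero residual at which the decrease of \<open>J\<close> per step tends to zero.\<close>

lemma orbit_almost_critical:
  assumes u: "supported A u" and below: "\<And>k. c \<le> J A ((step ^^ k) u)" and "\<sigma> > 0"
  shows "\<exists>k. residual2 A ((step ^^ k) u) < \<sigma>"
proof (rule ccontr)
  assume "\<nexists>k. residual2 A ((step ^^ k) u) < \<sigma>"
  then have ge: "residual2 A ((step ^^ k) u) \<ge> \<sigma>" for k
    by (auto simp: not_less)
  define U where "U k = (step ^^ k) u" for k
  define a where "a k = \<tau> (U k) * residual2 A (U k)" for k
  have \<tau>_pos: "\<tau> v > 0" for v
    by (simp add: \<tau>_def T_pos)
  have a_nonneg: "a k \<ge> 0" for k
    using \<tau>_pos[of "U k"] residual2_nonneg[of "U k"] by (simp add: a_def)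
  \<comment> \<open>Telescoping: the decreases of \<open>J\<close> sum to at most
    \<open>J A u - c\<close>, so \<open>a\<close> is summable.\<close>
  have partial: "(\<Sum>i<k. a i) / 2 \<le> J A u - J A (U k)" for k
  proof (induction k)
    case (Suc k)
    then show ?case
      using J_step_decrease[OF supported_orbit[OF u, of k]] by (simp add: U_def a_def add_divide_distrib)
  qed (simp add: U_def)
  have "(\<Sum>i<k. a i) \<le> 2 * (J A u - c)" for k
    using partial[of k] below[of k] by (simp add: U_def)
  then have summable_a: "summable a"
    by (intro bounded_imp_summable[of _ "2 * (J A u - c)"] a_nonneg)
      (metis lessThan_Suc_atMost)
  \<comment> \<open>With \<open>?N \<ge> \<sigma>\<close> the gradient satisfies
    \<open>sqrt ?N \<le> ?N / sqrt \<sigma>\<close>, so the summable decreases dominate the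
    increments and the orbit converges pointwise.\<close>
  have inc: "\<bar>U (Suc k) x - U k x\<bar> \<le> a k / sqrt \<sigma>" for k x
  proof -
    have "\<bar>steepest A (U k) x\<bar> \<le> residual2 A (U k) / sqrt \<sigma>"
    proof -
      let ?N = "residual2 A (U k)"
      have "?N \<ge> \<sigma>"
        using ge by (simp add: U_def)
      have "(steepest A (U k) x)\<^sup>2 \<le> ?N"
      proof (cases "x \<in> A")
        case True
        then show ?thesis
          unfolding residual2_def steepest_def using A member_le_sum[of x A "\<lambda>x. (residual (U k) x)\<^sup>2"] by simp
      qed (simp add: steepest_def residual2_nonneg)
      then have "\<bar>steepest A (U k) x\<bar> \<le> sqrt ?N"
        by (metis real_sqrt_abs real_sqrt_le_iff)
      also have "\<dots> * sqrt \<sigma> \<le> sqrt ?N * sqrt ?N"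
        using \<open>?N \<ge> \<sigma>\<close> \<open>\<sigma> > 0\<close> by (intro mult_left_mono) auto
      then have "sqrt ?N \<le> ?N / sqrt \<sigma>"
        using \<open>\<sigma> > 0\<close> residual2_nonneg[of "U k"] by (simp add: field_simps)
      finally show ?thesis .
    qed
    then have "\<tau> (U k) * \<bar>steepest A (U k) x\<bar> \<le> \<tau> (U k) * (residual2 A (U k) / sqrt \<sigma>)"
      using \<tau>_pos[of "U k"] by (intro mult_left_mono) auto
    then show ?thesis
      using \<tau>_pos[of "U k"] by (simp add: U_def step_def a_def abs_mult)
  qed
  have "\<exists>l. (\<lambda>k. U k x) \<longlonglongrightarrow> l" for x
  proof -
    have "summable (\<lambda>k. U (Suc k) x - U k x)"
      using inc by (intro summable_comparison_test'[OF summable_divide[OF summable_a, of "sqrt \<sigma>"], of 0]) auto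
    then have "(\<lambda>k. \<Sum>i<k. U (Suc i) x - U i x) \<longlonglongrightarrow> (\<Sum>k. U (Suc k) x - U k x)"
      by (rule summable_LIMSEQ)
    then have "(\<lambda>k. U k x - U 0 x + U 0 x) \<longlonglongrightarrow> (\<Sum>k. U (Suc k) x - U k x) + U 0 x"
      unfolding sum_lessThan_telescope[of "\<lambda>k. U k x"] by (intro tendsto_intros)
    then show ?thesis by auto
  qed
  then obtain v where v: "\<And>x. (\<lambda>k. U k x) \<longlonglongrightarrow> v x"
    by metis
  \<comment> \<open>Continuity of the step length enters here: the steps cannot shrink to zero,
    since their limit \<open>\<tau> v\<close> is positive.\<close>
  have "a \<longlonglongrightarrow> \<tau> v * residual2 A v"
    unfolding a_def by (intro tendsto_intros tendsto_\<tau> tendsto_residual2 v)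
  moreover have "a \<longlonglongrightarrow> 0"
    using summable_a by (rule summable_LIMSEQ_zero)
  ultimately have "\<tau> v * residual2 A v = 0"
    using LIMSEQ_unique by blast
  moreover have "residual2 A v \<ge> \<sigma>"
    using tendsto_residual2[of U v sequentially A, OF v] ge
    by (intro tendsto_lowerbound[where F = sequentially]) (auto simp: U_def)
  ultimately show False
    using \<tau>_pos[of v] \<open>\<sigma> > 0\<close> by simp
qed

section \<open>Orbits below the barrier\<close>

context
  fixes \<delta> r :: real
  assumes delta_pos: "\<delta> > 0" and r_pos: "r > 0"
    and barrier: "\<And>u. supported A u \<Longrightarrow> energy A u = r\<^sup>2 \<Longrightarrow> \<delta> \<le> J A u"
begin

lemma step_segment_avoids_barrier:
  assumes u: "supported A u" and "J A u < \<delta>" and s: "0 \<le> s" "s \<le> 1"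
  shows "energy A (\<lambda>x. u x + s * (step u x - u x)) \<noteq> r\<^sup>2"
proof
  assume "energy A (\<lambda>x. u x + s * (step u x - u x)) = r\<^sup>2"
  moreover have "supported A (\<lambda>x. u x + s * (step u x - u x))"
    using u supported_step[OF u] by (simp add: supported_def)
  ultimately have "\<delta> \<le> J A (\<lambda>x. u x + s * (step u x - u x))"
    by (rule barrier[rotated])
  then show False
    using J_segment[OF u s] assms(2) by linarith
qed

text \<open>A step that changed sides would meet the sphere somewhere on its segment by the
  intermediate value theorem; there \<open>J\<close> is at least \<open>\<delta>\<close>, although
  it is at most \<open>J A u\<close> along the segment.\<close>

lemma step_stays_on_side:
  assumes u: "supported A u" and J: "J A u < \<delta>"
  shows "energy A (step u) < r\<^sup>2 \<longleftrightarrow> energy A u < r\<^sup>2"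
proof -
  define e where "e s = energy A (\<lambda>x. u x + s * (step u x - u x))" for s
  have e: "e 0 = energy A u" "e 1 = energy A (step u)"
    by (simp_all add: e_def)
  have cont: "continuous_on {0..1} e"
    unfolding e_def continuous_on_def by (auto intro!: tendsto_energy tendsto_intros)
  have ne: "e s \<noteq> r\<^sup>2" if "0 \<le> s" "s \<le> 1" for s
    unfolding e_def using that by (rule step_segment_avoids_barrier[OF u J])
  show ?thesis
    using IVT'[of e 0 "r\<^sup>2" 1] IVT2'[of e 1 "r\<^sup>2" 0] cont ne e
    by (metis less_eq_real_def linorder_not_less zero_le_one order_refl)
qed

lemma orbit_stays_on_side:
  assumes u: "supported A u" and J: "J A ((step ^^ m) u) < \<delta>" and "m \<le> n"
  shows "J A ((step ^^ n) u) < \<delta>"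
    and "energy A ((step ^^ n) u) < r\<^sup>2 \<longleftrightarrow> energy A ((step ^^ m) u) < r\<^sup>2"
proof -
  have "J A ((step ^^ n) u) < \<delta> \<and> (energy A ((step ^^ n) u) < r\<^sup>2 \<longleftrightarrow> energy A ((step ^^ m) u) < r\<^sup>2)"
    using \<open>m \<le> n\<close>
  proof (induction n rule: dec_induct)
    case (step n)
    then show ?case
      using step_stays_on_side[OF supported_orbit[OF u, of n]] J_step_le[OF supported_orbit[OF u, of n]] by simp
  qed (use J in simp)
  then show "J A ((step ^^ n) u) < \<delta>"
    and "energy A ((step ^^ n) u) < r\<^sup>2 \<longleftrightarrow> energy A ((step ^^ m) u) < r\<^sup>2"
    by auto
qed

lemma supported_zero: "supported A (\<lambda>x. 0)"
  by (simp add: supported_def)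

lemma energy_zero: "energy A (\<lambda>x. 0) = 0"
  by (simp add: energy_def)

lemma J_zero: "J A (\<lambda>x. 0) = 0"
  by (simp add: J_def energy_zero primitive_trunc_neg)

text \<open>The orbit of 0 starts inside the sphere with \<open>J = 0 < \<delta>\<close> and so
  remains inside, where \<open>c\<close> bounds \<open>J\<close> from below and
  \<open>orbit_almost_critical\<close> applies.\<close>

lemma small_almost_critical:
  assumes below: "\<And>u. supported A u \<Longrightarrow> energy A u \<le> r\<^sup>2 \<Longrightarrow> c \<le> J A u" and "\<sigma> > 0"
  obtains u where "supported A u" "energy A u \<le> r\<^sup>2" "J A u \<le> 0" "residual2 A u < \<sigma>"
proof -
  let ?U = "\<lambda>k. (step ^^ k) (\<lambda>x. 0)"
  have en: "energy A (?U k) < r\<^sup>2" for k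
    using orbit_stays_on_side(2)[OF supported_zero, of 0 k] delta_pos zero_less_power[OF r_pos, of 2]
    by (simp add: J_zero energy_zero)
  have "c \<le> J A (?U k)" for k
    using below[OF supported_orbit[OF supported_zero, of k]] en[of k] by simp
  then obtain k where "residual2 A (?U k) < \<sigma>"
    using orbit_almost_critical[OF supported_zero _ \<open>\<sigma> > 0\<close>] by blast
  then show thesis
    using that[of "?U k"] supported_orbit[OF supported_zero, of k] en[of k]
      J_orbit_le[OF supported_zero, of k] by (simp add: J_zero)
qed

text \<open>Shooting in place of a minimax over paths: the starting points on the segment from \<open>0\<close> to \<open>e\<close>
  whose orbit falls below \<open>\<delta>\<close> inside the sphere, and those whose orbit does so outside, form disjoint
  open sets, so some orbit stays above \<open>\<delta>\<close>.\<close>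

lemma mountain_pass_almost_critical:
  assumes e: "supported A e" and far: "energy A e > r\<^sup>2" and low: "J A e < \<delta>" and "\<sigma> > 0"
  obtains v t where "supported A v" "\<delta> \<le> J A v" "0 \<le> t" "t \<le> 1" "J A v \<le> J A (\<lambda>x. t * e x)"
    "residual2 A v < \<sigma>"
proof -
  let ?I = "{0..1::real}"
  define U where "U k t = (step ^^ k) (\<lambda>x. t * e x)" for k and t :: real
  have supp0: "supported A (\<lambda>x. t * e x)" for t
    using e by (simp add: supported_def)
  have supp: "supported A (U k t)" for k t
    unfolding U_def by (rule supported_orbit[OF supp0])
  define S0 where "S0 = (\<Union>k. {t \<in> ?I. J A (U k t) < \<delta> \<and> energy A (U k t) < r\<^sup>2})"
  define S1 where "S1 = (\<Union>k. {t \<in> ?I. J A (U k t) < \<delta> \<and> energy A (U k t) > r\<^sup>2})"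
  have cont: "continuous_on ?I (\<lambda>t. J A (U k t))" "continuous_on ?I (\<lambda>t. energy A (U k t))" for k
    unfolding continuous_on_def U_def
    by (auto intro!: tendsto_J tendsto_energy tendsto_orbit tendsto_intros)
  have "openin (top_of_set ?I) S0"
  proof -
    have "{t \<in> ?I. J A (U k t) < \<delta> \<and> energy A (U k t) < r\<^sup>2} =
        (?I \<inter> (\<lambda>t. J A (U k t)) -` {..<\<delta>}) \<inter> (?I \<inter> (\<lambda>t. energy A (U k t)) -` {..<r\<^sup>2})" for k
      by auto
    then show ?thesis
      unfolding S0_def by (auto intro!: openin_Union openin_Int continuous_openin_preimage_gen cont)
  qed
  moreover have "openin (top_of_set ?I) S1"
  proof -
    have "{t \<in> ?I. J A (U k t) < \<delta> \<and> energy A (U k t) > r\<^sup>2} =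
        (?I \<inter> (\<lambda>t. J A (U k t)) -` {..<\<delta>}) \<inter> (?I \<inter> (\<lambda>t. energy A (U k t)) -` {r\<^sup>2<..})" for k
      by auto
    then show ?thesis
      unfolding S1_def by (auto intro!: openin_Union openin_Int continuous_openin_preimage_gen cont)
  qed
  moreover have "S0 \<inter> S1 = {}"
  proof (rule ccontr)
    assume "S0 \<inter> S1 \<noteq> {}"
    then obtain t k l where kl: "J A (U k t) < \<delta>" "energy A (U k t) < r\<^sup>2"
        "J A (U l t) < \<delta>" "energy A (U l t) > r\<^sup>2"
      by (auto simp: S0_def S1_def)
    \<comment> \<open>At the later of the two times the orbit would lie on both sides of the
      sphere.\<close>
    then show False
      using orbit_stays_on_side(2)[OF supp0, of k t "max k l"] orbit_stays_on_side(2)[OF supp0, of l t "max k l"]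
      by (auto simp: U_def)
  qed
  moreover have "0 \<in> S0"
    by (auto simp: S0_def U_def J_zero energy_zero delta_pos less_imp_neq[OF r_pos, symmetric] intro!: exI[of _ 0])
  moreover have "1 \<in> S1"
    using far low by (auto simp: S1_def U_def intro!: exI[of _ 0])
  moreover have "connected ?I"
    by simp
  ultimately have "\<not> ?I \<subseteq> S0 \<union> S1"
    unfolding connected_openin by blast
  then obtain t where t: "t \<in> ?I" "t \<notin> S0" "t \<notin> S1"
    by blast
  \<comment> \<open>A point of the orbit below \<open>\<delta>\<close> is not on the sphere by the
    barrier, so it would put \<open>t\<close> into \<open>S0\<close> or \<open>S1\<close>.\<close>
  have above: "\<delta> \<le> J A (U k t)" for k
  proof (rule ccontr)
    assume "\<not> \<delta> \<le> J A (U k t)"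
    moreover from this have "energy A (U k t) \<noteq> r\<^sup>2"
      using barrier[OF supp] by blast
    ultimately show False
      using t by (force simp: S0_def S1_def not_le)
  qed
  obtain k where "residual2 A (U k t) < \<sigma>"
    using orbit_almost_critical[OF supp0 _ \<open>\<sigma> > 0\<close>, of \<delta> t] above by (auto simp: U_def)
  then show thesis
    using that[of "U k t" t] supp above t J_orbit_le[OF supp0, of k t] by (auto simp: U_def)
qed

end

end

section \<open>Pointwise decay and coercivity of the potential\<close>

context weighted_graph
begin

lemma pointwise_energy_bound:
  assumes "finite A" "supported A u"
  shows "\<mu>_min * h x * (u x)\<^sup>2 \<le> energy A u"
proof (cases "x \<in> A")
  case True
  have "\<mu>_min * h x * (u x)\<^sup>2 \<le> \<mu> x * h x * (u x)\<^sup>2"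
    using mu_ge[of x] h_pos[of x] by (intro mult_right_mono) auto
  also have "\<dots> \<le> (\<Sum>x\<in>A. \<mu> x * h x * (u x)\<^sup>2)"
    using True assms(1)
    by (intro member_le_sum) (auto simp: less_imp_le[OF mu_pos] less_imp_le[OF h_pos])
  also have "\<dots> \<le> energy A u"
    by (rule energy_ge[OF assms])
  finally show ?thesis .
qed (use assms energy_nonneg in \<open>auto simp: supported_def\<close>)

text \<open>The bound is independent of \<open>A\<close> and decays where \<open>h\<close> grows. It
  supplies the compact box for the limit as well as the decay of the limit function.\<close>

lemma abs_le_of_energy:
  assumes "finite A" "supported A u" "energy A u \<le> r\<^sup>2" "r \<ge> 0"
  shows "\<bar>u x\<bar> \<le> r / sqrt (\<mu>_min * h x)"
proof -
  have pos: "\<mu>_min * h x > 0"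
    using mu_min_pos h_pos[of x] by simp
  have "\<mu>_min * h x * (u x)\<^sup>2 \<le> r\<^sup>2"
    using pointwise_energy_bound[OF assms(1,2), of x] assms(3) by linarith
  then have "sqrt (\<mu>_min * h x * (u x)\<^sup>2) \<le> sqrt (r\<^sup>2)"
    by (rule real_sqrt_le_mono)
  then have "sqrt (\<mu>_min * h x) * \<bar>u x\<bar> \<le> r"
    using assms(4) by (simp add: real_sqrt_mult)
  then show ?thesis
    using pos by (simp add: field_simps)
qed

lemma abs_le_of_energy_uniform:
  assumes "finite A" "supported A u" "energy A u \<le> r\<^sup>2" "r \<ge> 0"
  shows "\<bar>u x\<bar> \<le> r / sqrt (\<mu>_min * h0)"
proof -
  have "r / sqrt (\<mu>_min * h x) \<le> r / sqrt (\<mu>_min * h0)"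
    using assms(4) mu_min_pos h0_pos h_ge[of x]
    by (intro divide_left_mono) auto
  then show ?thesis
    using abs_le_of_energy[OF assms, of x] by linarith
qed

lemma mass_le_energy:
  assumes "finite A" "supported A u"
  shows "h0 * (\<Sum>x\<in>A. \<mu> x * (u x)\<^sup>2) \<le> energy A u"
proof -
  have "h0 * (\<Sum>x\<in>A. \<mu> x * (u x)\<^sup>2) \<le> (\<Sum>x\<in>A. \<mu> x * h x * (u x)\<^sup>2)"
    unfolding sum_distrib_left
    using h_ge mu_pos by (intro sum_mono) (simp add: mult_right_mono mult_left_mono less_imp_le mult.left_commute[of h0] mult.assoc)
  then show ?thesis
    using energy_ge[OF assms] by linarith
qed

lemma finite_relpow_preimage: "finite {x. (x, y) \<in> E ^^ n}"
proof (induction n arbitrary: y)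
  case (Suc n)
  have "{x. (x, y) \<in> E ^^ Suc n} = (\<Union>z\<in>E `` {y}. {x. (x, z) \<in> E ^^ n})"
    using graph by (auto simp: sym_def)
  then show ?case
    using Suc loc_finite by simp
qed simp

context
  fixes x0 :: 'v
  assumes h_coercive: "\<forall>C. \<exists>N::nat. \<forall>x. graph_dist E x x0 \<ge> enat N \<longrightarrow> h x \<ge> C"
begin

lemma path_below: "\<exists>N. \<forall>x. h x < c \<longrightarrow> (\<exists>n<N. (x, x0) \<in> E ^^ n)"
proof -
  obtain N where N: "\<And>x. graph_dist E x x0 \<ge> enat N \<Longrightarrow> h x \<ge> c"
    using h_coercive by blast
  have "\<exists>n<N. (x, x0) \<in> E ^^ n" if "h x < c" for x
  proof -
    have "graph_dist E x x0 < enat N"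
      using N[of x] that by force
    then show ?thesis
      by (auto simp: graph_dist_def INF_less_iff)
  qed
  then show ?thesis by blast
qed

lemma finite_sublevel: "finite {x. h x < c}"
proof -
  obtain N where "\<And>x. h x < c \<Longrightarrow> \<exists>n<N. (x, x0) \<in> E ^^ n"
    using path_below by blast
  then have "{x. h x < c} \<subseteq> (\<Union>n<N. {x. (x, x0) \<in> E ^^ n})"
    by auto
  then show ?thesis
    by (rule finite_subset) (simp add: finite_relpow_preimage)
qed

text \<open>A vertex not joined to \<open>x0\<close> has infinite distance, which exceeds every
  \<open>N\<close>; coercivity would then force \<open>h\<close> above every constant at this
  vertex.\<close>

lemma connected_graph: "(x, y) \<in> E\<^sup>*"
proof -
  have "(z, x0) \<in> E\<^sup>*" for z
    using path_below[of "h z + 1"] by (metis less_add_one relpow_imp_rtrancl)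
  moreover have "sym (E\<^sup>*)"
    using graph by (rule sym_rtrancl)
  ultimately show ?thesis
    by (meson rtrancl_trans symD)
qed

end

end

section \<open>Estimates uniform in the vertex set\<close>

context perturbed_problem
begin

text \<open>In the ball of radius \<open>r\<close> all values lie in the range of
  \<open>small\<close>, so the nonlinear term takes at most 1/8 of the energy from the available
  1/2.\<close>

lemma J_lower_bound:
  assumes A: "finite A" and u: "supported A u" and "energy A u \<le> r\<^sup>2" "r \<ge> 0"
    and small: "\<And>x s. \<bar>s\<bar> \<le> r / sqrt (\<mu>_min * h0) \<Longrightarrow> primitive trunc x s \<le> h0 / 8 * s\<^sup>2"
  shows "3 / 8 * energy A u - \<epsilon> * C * sqrt (energy A u) \<le> J A u"
proof -
  have "(\<Sum>x\<in>A. \<mu> x * primitive trunc x (u x)) \<le> (\<Sum>x\<in>A. \<mu> x * (h0 / 8 * (u x)\<^sup>2))"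
    using abs_le_of_energy_uniform[OF assms(1-4)]
    by (intro sum_mono mult_left_mono small) (auto simp: less_imp_le[OF mu_pos])
  also have "\<dots> = h0 * (\<Sum>x\<in>A. \<mu> x * (u x)\<^sup>2) / 8"
    by (simp add: sum_distrib_left sum_divide_distrib mult_ac)
  also have "\<dots> \<le> energy A u / 8"
    using mass_le_energy[OF A u] by simp
  finally have 1: "(\<Sum>x\<in>A. \<mu> x * primitive trunc x (u x)) \<le> energy A u / 8" .
  have "\<epsilon> * (\<Sum>x\<in>A. \<mu> x * g x * u x) \<le> \<epsilon> * (C * sqrt (energy A u))"
    using g_bound[OF A u] eps_nonneg by (intro mult_left_mono) auto
  with 1 show ?thesis
    by (simp add: J_def)
qed

text \<open>Cauchy-Schwarz; the factor \<open>\<mu>_min * h0\<close> in the assumption is the one by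
  which the energy controls the sum of squares of \<open>u\<close>.\<close>

lemma residual_pairing_bound:
  assumes A: "finite A" and u: "supported A u" and res: "residual2 A u \<le> \<sigma>\<^sup>2 * (\<mu>_min * h0)" and "\<sigma> \<ge> 0"
  shows "\<bar>\<Sum>x\<in>A. u x * residual u x\<bar> \<le> \<sigma> * sqrt (energy A u)"
proof -
  have "\<mu>_min * h0 * (\<Sum>x\<in>A. (u x)\<^sup>2) = h0 * (\<Sum>x\<in>A. \<mu>_min * (u x)\<^sup>2)"
    by (simp add: sum_distrib_left mult_ac)
  also have "\<dots> \<le> h0 * (\<Sum>x\<in>A. \<mu> x * (u x)\<^sup>2)"
    using h0_pos mu_ge by (intro mult_left_mono sum_mono mult_right_mono) auto
  also have "\<dots> \<le> energy A u"
    by (rule mass_le_energy[OF A u])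
  finally have mass: "\<mu>_min * h0 * (\<Sum>x\<in>A. (u x)\<^sup>2) \<le> energy A u" .
  have "(\<Sum>x\<in>A. u x * residual u x)\<^sup>2 \<le> (\<Sum>x\<in>A. (u x)\<^sup>2) * residual2 A u"
    unfolding residual2_def by (rule Cauchy_Schwarz_ineq_sum)
  also have "\<dots> \<le> (\<Sum>x\<in>A. (u x)\<^sup>2) * (\<sigma>\<^sup>2 * (\<mu>_min * h0))"
    by (intro mult_left_mono res sum_nonneg) auto
  also have "\<dots> = \<sigma>\<^sup>2 * (\<mu>_min * h0 * (\<Sum>x\<in>A. (u x)\<^sup>2))"
    by simp
  also have "\<dots> \<le> \<sigma>\<^sup>2 * energy A u"
    by (intro mult_left_mono mass) auto
  finally have "sqrt ((\<Sum>x\<in>A. u x * residual u x)\<^sup>2) \<le> sqrt (\<sigma>\<^sup>2 * energy A u)"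
    by (rule real_sqrt_le_mono)
  then show ?thesis
    using \<open>\<sigma> \<ge> 0\<close> by (simp add: real_sqrt_mult)
qed

lemma residual_pairing:
  "(\<Sum>x\<in>A. u x * residual u x) =
    energy A u - (\<Sum>x\<in>A. \<mu> x * (u x * trunc x (u x))) - \<epsilon> * (\<Sum>x\<in>A. \<mu> x * g x * u x)"
  by (simp add: residual_def energy_def algebra_simps sum.distrib sum_subtractf sum_distrib_left)

text \<open>The Ambrosetti-Rabinowitz argument: in \<open>\<theta> * J A u\<close> minus the
  derivative of \<open>J A\<close> in direction \<open>u\<close>, the nonlinear terms have a
  favourable sign. What remains is a quadratic in \<open>p\<close> bounded by a linear expression,
  and \<open>R\<close> depends on \<open>\<theta>\<close>, \<open>c\<close> and \<open>C\<close> but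
  not on \<open>A\<close>.\<close>

lemma energy_bound:
  assumes A: "finite A" and u: "supported A u"
    and pair: "\<bar>\<Sum>x\<in>A. u x * residual u x\<bar> \<le> sqrt (energy A u)"
    and J: "J A u \<le> c" "0 \<le> c" and "\<epsilon> \<le> 1"
    and R: "R = 1 + (\<theta> * c + 1 + \<theta> * C) / (\<theta> / 2 - 1)"
  shows "energy A u \<le> R\<^sup>2"
proof -
  define p where "p = sqrt (energy A u)"
  have p: "p \<ge> 0" "p\<^sup>2 = energy A u"
    using energy_nonneg[OF A u] by (auto simp: p_def)
  define a where "a = \<theta> / 2 - 1"
  have "a > 0"
    using theta by (simp add: a_def)
  define b where "b = \<theta> * c + 1 + \<theta> * C"
  have "\<theta> * c \<ge> 0" "\<theta> * C \<ge> 0"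
    using theta J C_nonneg by auto
  have "(\<Sum>x\<in>A. \<mu> x * (\<theta> * primitive trunc x (u x))) \<le> (\<Sum>x\<in>A. \<mu> x * (u x * trunc x (u x)))"
    by (intro sum_mono mult_left_mono trunc_superlinear) (auto simp: less_imp_le[OF mu_pos])
  then have AR: "\<theta> * (\<Sum>x\<in>A. \<mu> x * primitive trunc x (u x)) \<le> (\<Sum>x\<in>A. \<mu> x * (u x * trunc x (u x)))"
    by (simp add: sum_distrib_left mult_ac)
  define G where "G = \<epsilon> * (\<Sum>x\<in>A. \<mu> x * g x * u x)"
  have "\<bar>G\<bar> \<le> 1 * (C * p)"
    unfolding G_def abs_mult p_def using g_bound[OF A u] eps_nonneg \<open>\<epsilon> \<le> 1\<close>
    by (intro mult_mono) auto
  then have "(\<theta> - 1) * G \<le> (\<theta> - 1) * (C * p)"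
    using theta by (intro mult_left_mono) auto
  also have "\<dots> \<le> \<theta> * (C * p)"
    using theta C_nonneg p(1) by (intro mult_right_mono) auto
  finally have G: "(\<theta> - 1) * G \<le> \<theta> * C * p"
    by simp
  have "\<theta> * J A u = \<theta> * (energy A u / 2) - \<theta> * (\<Sum>x\<in>A. \<mu> x * primitive trunc x (u x)) - \<theta> * G"
    by (simp add: J_def G_def right_diff_distrib)
  moreover have "\<theta> * J A u \<le> \<theta> * c"
    using J theta by (intro mult_left_mono) auto
  moreover have "- p \<le> energy A u - (\<Sum>x\<in>A. \<mu> x * (u x * trunc x (u x))) - G"
    using pair unfolding residual_pairing G_def p_def by linarith
  moreover have "a * p\<^sup>2 = \<theta> * (energy A u / 2) - energy A u"
    by (simp add: p a_def algebra_simps)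
  moreover have "(\<theta> - 1) * G = \<theta> * G - G"
    by (simp add: algebra_simps)
  ultimately have quad: "a * p\<^sup>2 \<le> \<theta> * c + p + \<theta> * C * p"
    using AR G by linarith
  \<comment> \<open>For \<open>p > 1\<close> the constant term is absorbed into the linear one and
    \<open>p\<close> is cancelled; the summand 1 covers \<open>p \<le> 1\<close>.\<close>
  have "p \<le> 1 + b / a"
  proof (cases "p \<le> 1")
    case True
    moreover have "b / a \<ge> 0"
      using \<open>a > 0\<close> \<open>\<theta> * c \<ge> 0\<close> \<open>\<theta> * C \<ge> 0\<close> by (simp add: b_def)
    ultimately show ?thesis by linarith
  next
    case False
    then have "\<theta> * c * 1 \<le> \<theta> * c * p"
      using \<open>\<theta> * c \<ge> 0\<close> by (intro mult_left_mono) auto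
    then have "a * p * p \<le> b * p"
      using quad by (simp add: b_def algebra_simps power2_eq_square)
    then have "a * p \<le> b"
      using False by simp
    then have "p \<le> b / a"
      using \<open>a > 0\<close> by (simp add: field_simps)
    then show ?thesis by simp
  qed
  then have "p \<le> R"
    by (simp add: R a_def b_def)
  then show ?thesis
    using p power_mono[of p R 2] by simp
qed

text \<open>Subtracting half the derivative in direction \<open>u\<close> from \<open>J A u\<close>
  cancels the energy. The pairing and the term with \<open>g\<close> cost at most
  \<open>\<delta> / 4\<close> each, so the sum of \<open>\<mu> x * (u x * trunc x (u x))\<close> is
  at least \<open>\<delta>\<close>, and it is at most \<open>L\<close> times the mass.\<close>

lemma mass_lower_bound:
  assumes A: "finite A" and u: "supported A u"
    and pair: "\<bar>\<Sum>x\<in>A. u x * residual u x\<bar> \<le> \<delta> / 2"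
    and J: "\<delta> \<le> J A u" and en: "energy A u \<le> R\<^sup>2" and "R \<ge> 0"
    and eps: "\<epsilon> * C * R \<le> \<delta> / 2"
    and L: "\<And>x s. \<bar>s\<bar> \<le> R / sqrt (\<mu>_min * h0) \<Longrightarrow> trunc x s \<le> L * \<bar>s\<bar>"
  shows "\<delta> \<le> L * (\<Sum>x\<in>A. \<mu> x * (u x)\<^sup>2)"
proof -
  define G where "G = \<epsilon> * (\<Sum>x\<in>A. \<mu> x * g x * u x)"
  have "sqrt (energy A u) \<le> R"
    using real_sqrt_le_mono[OF en] \<open>R \<ge> 0\<close> by simp
  then have "C * sqrt (energy A u) \<le> C * R"
    using C_nonneg by (rule mult_left_mono)
  then have "\<bar>\<Sum>x\<in>A. \<mu> x * g x * u x\<bar> \<le> C * R"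
    using g_bound[OF A u] by linarith
  then have "\<bar>G\<bar> \<le> \<epsilon> * (C * R)"
    unfolding G_def abs_mult using eps_nonneg by (simp add: mult_left_mono)
  then have "\<bar>G\<bar> \<le> \<delta> / 2"
    using eps by simp
  moreover have "0 \<le> (\<Sum>x\<in>A. \<mu> x * primitive trunc x (u x))"
    using primitive_trunc_nonneg by (intro sum_nonneg mult_nonneg_nonneg) (auto simp: less_imp_le[OF mu_pos])
  moreover have "(\<Sum>x\<in>A. \<mu> x * (u x * trunc x (u x))) \<le> L * (\<Sum>x\<in>A. \<mu> x * (u x)\<^sup>2)"
    unfolding sum_distrib_left
  proof (rule sum_mono)
    fix x
    have "u x * trunc x (u x) \<le> \<bar>u x\<bar> * trunc x (u x)"
      using trunc_nonneg by (intro mult_right_mono) auto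
    also have "\<dots> \<le> \<bar>u x\<bar> * (L * \<bar>u x\<bar>)"
      using abs_le_of_energy_uniform[OF A u en \<open>R \<ge> 0\<close>] by (intro mult_left_mono L) auto
    also have "\<dots> = L * (u x)\<^sup>2"
      by (simp add: power2_eq_square)
    finally show "\<mu> x * (u x * trunc x (u x)) \<le> L * (\<mu> x * (u x)\<^sup>2)"
      using mu_pos[of x] mult_left_mono[of "u x * trunc x (u x)" "L * (u x)\<^sup>2" "\<mu> x"] by simp
  qed
  moreover have "J A u = energy A u / 2 - (\<Sum>x\<in>A. \<mu> x * primitive trunc x (u x)) - G"
    by (simp add: J_def G_def)
  moreover have "\<bar>energy A u - (\<Sum>x\<in>A. \<mu> x * (u x * trunc x (u x))) - G\<bar> \<le> \<delta> / 2"
    using pair unfolding residual_pairing G_def .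
  ultimately show ?thesis
    using J by linarith
qed

text \<open>Outside \<open>K\<close> the potential is at least \<open>H\<close>, so the energy bound
  leaves little mass there: none escapes to infinity as \<open>A\<close> grows.\<close>

lemma mass_concentrated:
  assumes A: "finite A" and u: "supported A u" and en: "energy A u \<le> R\<^sup>2"
    and H: "H > 0" and K: "finite K" "{x. h x < H} \<subseteq> K"
  shows "(\<Sum>x\<in>A. \<mu> x * (u x)\<^sup>2) \<le> (\<Sum>x\<in>K. \<mu> x * (u x)\<^sup>2) + R\<^sup>2 / H"
proof -
  have "H * (\<Sum>x\<in>A - K. \<mu> x * (u x)\<^sup>2) \<le> (\<Sum>x\<in>A - K. \<mu> x * h x * (u x)\<^sup>2)"
    unfolding sum_distrib_left
  proof (rule sum_mono)
    fix x assume "x \<in> A - K"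
    then have "H \<le> h x"
      using K by force
    then have "H * (\<mu> x * (u x)\<^sup>2) \<le> h x * (\<mu> x * (u x)\<^sup>2)"
      using mu_pos[of x] by (intro mult_right_mono) auto
    then show "H * (\<mu> x * (u x)\<^sup>2) \<le> \<mu> x * h x * (u x)\<^sup>2"
      by (simp add: mult_ac)
  qed
  also have "\<dots> \<le> (\<Sum>x\<in>A. \<mu> x * h x * (u x)\<^sup>2)"
    using A by (intro sum_mono2) (auto simp: less_imp_le[OF mu_pos] less_imp_le[OF h_pos])
  also have "\<dots> \<le> R\<^sup>2"
    using energy_ge[OF A u] en by linarith
  finally have "(\<Sum>x\<in>A - K. \<mu> x * (u x)\<^sup>2) \<le> R\<^sup>2 / H"
    using H by (simp add: field_simps)
  moreover have "(\<Sum>x\<in>A. \<mu> x * (u x)\<^sup>2) = (\<Sum>x\<in>A \<inter> K. \<mu> x * (u x)\<^sup>2) + (\<Sum>x\<in>A - K. \<mu> x * (u x)\<^sup>2)"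
    using A by (rule sum.Int_Diff)
  moreover have "(\<Sum>x\<in>A \<inter> K. \<mu> x * (u x)\<^sup>2) \<le> (\<Sum>x\<in>K. \<mu> x * (u x)\<^sup>2)"
    using K by (intro sum_mono2) (auto simp: less_imp_le[OF mu_pos])
  ultimately show ?thesis by linarith
qed

section \<open>Passage to the limit over finite vertex sets\<close>

text \<open>The box is compact in the product topology, and each condition on one residual is closed
  because it involves finitely many coordinates; the finite intersection property then yields an
  exact solution.\<close>

lemma limit_of_almost_solutions:
  assumes S: "closed S"
    and approx: "\<And>A \<sigma>. finite A \<Longrightarrow> \<sigma> > 0 \<Longrightarrow>
      \<exists>v\<in>S. (\<forall>x. \<bar>v x\<bar> \<le> B x) \<and> (\<forall>x\<in>A. \<bar>residual v x\<bar> \<le> \<sigma>)"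
  obtains v where "v \<in> S" "\<And>x. \<bar>v x\<bar> \<le> B x" "\<And>x. residual v x = 0"
proof -
  define Box where "Box = (\<Pi>\<^sub>E x\<in>UNIV. {- B x..B x})"
  define Z where "Z = (\<lambda>(x, n). {v. \<bar>residual v x\<bar> \<le> 1 / real (Suc n)})"
  have "compact Box"
  proof -
    have "compactin (product_topology (\<lambda>x. euclidean) UNIV) Box"
      unfolding Box_def compactin_PiE by auto
    then show ?thesis
      by (simp add: euclidean_product_topology)
  qed
  then have "compact (Box \<inter> S)"
    using S by (rule compact_Int_closed)
  moreover have "closed (Z i)" for i
  proof -
    have "continuous_on UNIV (\<lambda>v. residual v x)" for x
      unfolding continuous_on_def
      by (auto intro!: tendsto_residual simp: continuous_on_product_coordinates[unfolded continuous_on_def, rule_format])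
    then show ?thesis
      by (cases i) (auto simp: Z_def intro!: closed_Collect_le continuous_intros)
  qed
  moreover have "Box \<inter> S \<inter> \<Inter> (Z ` I) \<noteq> {}" if I: "finite I" for I
  proof -
    \<comment> \<open>Finitely many conditions involve finitely many vertices and a smallest
      tolerance; inserting 0 keeps \<open>Max\<close> meaningful for empty \<open>I\<close>.\<close>
    define m where "m = Max (insert 0 (snd ` I))"
    obtain v where v: "v \<in> S" "\<And>x. \<bar>v x\<bar> \<le> B x"
      "\<And>x. x \<in> fst ` I \<Longrightarrow> \<bar>residual v x\<bar> \<le> 1 / real (Suc m)"
      using approx[of "fst ` I" "1 / real (Suc m)"] I by auto
    have "v \<in> Z i" if "i \<in> I" for i
    proof -
      have "snd i \<le> m"
        unfolding m_def using I that by (intro Max_ge) auto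
      then have "1 / real (Suc m) \<le> 1 / real (Suc (snd i))"
        by (intro divide_left_mono) auto
      moreover have "\<bar>residual v (fst i)\<bar> \<le> 1 / real (Suc m)"
        using that by (intro v) auto
      ultimately show ?thesis
        by (simp add: Z_def case_prod_beta)
    qed
    moreover have "v \<in> Box"
      using v(2) by (auto simp: Box_def abs_le_iff) (metis minus_le_iff)
    ultimately show ?thesis
      using v(1) by blast
  qed
  ultimately have "Box \<inter> S \<inter> \<Inter> (Z ` UNIV) \<noteq> {}"
    by (rule compact_imp_fip_image)
  then obtain v where v: "v \<in> Box" "v \<in> S" "\<And>i. v \<in> Z i"
    by blast
  show thesis
  proof (rule that[OF v(2)])
    fix x
    show "\<bar>v x\<bar> \<le> B x"
      using v(1) by (auto simp: Box_def abs_le_iff PiE_iff) (metis minus_le_iff)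
    have le: "\<bar>residual v x\<bar> \<le> 1 / real (Suc n)" for n
      using v(3)[of "(x, n)"] by (simp add: Z_def)
    have "(\<lambda>n. 1 / real (Suc n)) \<longlonglongrightarrow> 0"
      using LIMSEQ_inverse_real_of_nat by (simp add: inverse_eq_divide)
    then have "\<bar>residual v x\<bar> \<le> 0"
      using le by (intro LIMSEQ_le_const) auto
    then show "residual v x = 0" by simp
  qed
qed

section \<open>Sign of exact solutions\<close>

text \<open>Minimum principle: by decay, a negative value forces a negative minimum to be attained.
  There \<open>schroedinger v\<close> is negative, while the truncated right-hand side is
  nonnegative everywhere.\<close>

lemma solution_nonneg:
  assumes sol: "\<And>x. residual v x = 0" and decay: "\<And>c. c > 0 \<Longrightarrow> finite {x. \<bar>v x\<bar> \<ge> c}"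
  shows "v x \<ge> 0"
proof (rule ccontr)
  assume neg: "\<not> v x \<ge> 0"
  let ?S = "{y. v y \<le> v x}"
  have "?S \<subseteq> {y. \<bar>v y\<bar> \<ge> - v x}"
    by auto
  then have "finite ?S"
    using decay[of "- v x"] neg by (auto intro: finite_subset)
  then obtain z where z: "z \<in> ?S" "\<And>y. y \<in> ?S \<Longrightarrow> v z \<le> v y"
    by (metis (mono_tags, lifting) arg_min_if_finite(1) arg_min_least emptyE mem_Collect_eq order_refl)
  then have min: "v z \<le> v y" for y
    using z by (cases "y \<in> ?S") force+
  have "v z < 0"
    using min[of x] neg by linarith
  have "(\<Sum>y\<in>E `` {z}. w z y * (v z - v y)) \<le> 0"
    using min by (intro sum_nonpos mult_nonneg_nonpos) (auto simp: less_imp_le[OF w_pos])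
  moreover have "\<mu> z * h z * v z < 0"
    using mu_pos[of z] h_pos[of z] \<open>v z < 0\<close> by (simp add: mult_pos_neg)
  moreover have "\<mu> z * trunc z (v z) \<ge> 0" "\<epsilon> * \<mu> z * g z \<ge> 0"
    using mu_pos[of z] trunc_nonneg[of z "v z"] g_nonneg[of z] eps_nonneg by auto
  ultimately show False
    using sol[of z] by (simp add: residual_def schroedinger_def)
qed

text \<open>Strong minimum principle: at a zero of \<open>v\<close> the equation forces all
  neighbours to be zeros, connectedness spreads this to the whole graph, and the equation then makes
  \<open>g\<close> vanish.\<close>

lemma solution_pos:
  assumes sol: "\<And>x. residual v x = 0" and nonneg: "\<And>x. v x \<ge> 0"
    and conn: "\<And>x y. (x, y) \<in> E\<^sup>*" and g: "\<exists>x. g x \<noteq> 0" and "\<epsilon> > 0"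
  shows "v x > 0"
proof (rule ccontr)
  assume "\<not> v x > 0"
  then have "v x = 0"
    using nonneg[of x] by simp
  have zero: "v y = 0" if "v z = 0" "(z, y) \<in> E" for y z
  proof -
    have "\<epsilon> * \<mu> z * g z \<ge> 0"
      using mu_pos[of z] g_nonneg[of z] eps_nonneg by simp
    then have "(\<Sum>y\<in>E `` {z}. w z y * v y) \<le> 0"
      using sol[of z] \<open>v z = 0\<close> by (simp add: residual_def schroedinger_def trunc_zero sum_negf)
    moreover have "w z y * v y \<ge> 0" if "y \<in> E `` {z}" for y
      using that w_pos[of z y] nonneg[of y] by simp
    ultimately have "w z y * v y \<le> 0"
      using member_le_sum[of y "E `` {z}" "\<lambda>y. w z y * v y"] loc_finite that(2) by force
    then show ?thesis
      using w_pos[OF that(2)] nonneg[of y] by (simp add: mult_le_0_iff)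
  qed
  have all: "v y = 0" for y
    using conn[of x y] by (induction rule: rtrancl_induct) (auto simp: \<open>v x = 0\<close> intro: zero)
  have "\<epsilon> * \<mu> y * g y = 0" for y
    using sol[of y] by (simp add: residual_def schroedinger_def all trunc_zero)
  then have "g y = 0" for y
    using mu_pos[of y] \<open>\<epsilon> > 0\<close> by (metis less_irrefl mult_eq_0_iff)
  then show False
    using g by blast
qed

lemma pos_solution_of_residual:
  assumes sol: "\<And>x. residual v x = 0" and pos: "\<And>x. v x > 0"
  shows "pos_solution E w \<mu> h f g \<epsilon> v"
  unfolding pos_solution_def
proof (intro conjI allI pos)
  fix x
  have "\<mu> x * (- laplacian E w \<mu> v x + h x * v x) = \<mu> x * (f x (v x) + \<epsilon> * g x)"
    using sol[of x] pos[of x]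
    by (simp add: residual_def schroedinger_eq_laplacian trunc_def max_def algebra_simps split: if_splits)
  then show "- laplacian E w \<mu> v x + h x * v x = f x (v x) + \<epsilon> * g x"
    using mu_pos[of x] by simp
qed

section \<open>Combination of the estimates\<close>

lemma almost_solutions_exist:
  assumes A: "finite A" and e: "supported A e"
    and r: "r > 0" and \<delta>: "\<delta> = r\<^sup>2 / 4"
    and small: "\<And>x s. \<bar>s\<bar> \<le> r / sqrt (\<mu>_min * h0) \<Longrightarrow> primitive trunc x s \<le> h0 / 8 * s\<^sup>2"
    and far: "r\<^sup>2 < energy A e" and low: "J A e \<le> 0"
    and c: "\<And>t. 0 \<le> t \<Longrightarrow> t \<le> 1 \<Longrightarrow> J A (\<lambda>x. t * e x) \<le> c" "0 \<le> c"
    and R: "R = 1 + (\<theta> * c + 1 + \<theta> * C) / (\<theta> / 2 - 1)"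
    and eps: "\<epsilon> \<le> 1" "\<epsilon> * C \<le> r / 8" and "\<sigma> > 0"
  obtains u v where
    "supported A u" "energy A u \<le> r\<^sup>2" "J A u \<le> 0" "residual2 A u < \<sigma>"
    "supported A v" "energy A v \<le> R\<^sup>2" "\<delta> \<le> J A v" "residual2 A v < \<sigma>"
    "\<bar>\<Sum>x\<in>A. v x * residual v x\<bar> \<le> \<delta> / 2"
proof -
  define P where "P M \<tau> \<longleftrightarrow> (\<forall>u s. supported A u \<longrightarrow> magnitude A u \<le> M \<longrightarrow> 0 \<le> s \<longrightarrow> s \<le> \<tau> \<longrightarrow>
    J A (\<lambda>x. u x + s * steepest A u x) \<le> J A u - s / 2 * residual2 A u)" for M \<tau>
  have P_ex: "\<exists>\<tau>>0. P M \<tau>" for M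
    unfolding P_def using A by (rule admissible_step_exists)
  have P_mono: "P M' \<tau>'" if "P M \<tau>" "M' \<le> M" "\<tau>' \<le> \<tau>" for M \<tau> M' \<tau>'
    using that unfolding P_def by (meson order_trans)
  obtain T where T: "continuous_on UNIV T" "\<And>M. T M > 0" "\<And>M. P M (T M)"
    by (rule continuous_positive_selection[of P, OF P_ex]) (erule (2) P_mono, blast)
  interpret steepest_descent E w \<mu> h \<mu>_min h0 f \<theta> g C \<epsilon> A T
    using T(3) by unfold_locales (auto simp: A T(1,2) P_def)
  have "\<delta> > 0"
    using r by (simp add: \<delta>)
  have lower: "3 / 8 * energy A u - r / 8 * sqrt (energy A u) \<le> J A u"
    if "supported A u" "energy A u \<le> r\<^sup>2" for u
  proof -
    have "\<epsilon> * C * sqrt (energy A u) \<le> r / 8 * sqrt (energy A u)"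
      using eps(2) by (intro mult_right_mono) (auto simp: energy_nonneg A that)
    then show ?thesis
      using J_lower_bound[OF A that _ small] r by simp
  qed
  \<comment> \<open>On the sphere the lower bound is 3/8 - 1/8 = 1/4 of \<open>r\<^sup>2\<close>,
    which explains the value of \<open>\<delta>\<close>.\<close>
  have barrier: "\<delta> \<le> J A u" if "supported A u" "energy A u = r\<^sup>2" for u
    using lower[OF that(1)] that(2) r by (simp add: \<delta> power2_eq_square)
  have below: "- (r\<^sup>2 / 8) \<le> J A u" if "supported A u" "energy A u \<le> r\<^sup>2" for u
  proof -
    have "sqrt (energy A u) \<le> r"
      using real_sqrt_le_mono[OF that(2)] r by simp
    then have "r / 8 * sqrt (energy A u) \<le> r / 8 * r"
      using r by (intro mult_left_mono) auto
    then show ?thesis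
      using lower[OF that] energy_nonneg[OF A that(1)] by (simp add: power2_eq_square)
  qed
  obtain u where u: "supported A u" "energy A u \<le> r\<^sup>2" "J A u \<le> 0" "residual2 A u < \<sigma>"
    using small_almost_critical[OF \<open>\<delta> > 0\<close> r barrier below \<open>\<sigma> > 0\<close>] by blast
  have "\<theta> * c + 1 + \<theta> * C \<ge> 0"
    using theta c(2) C_nonneg by auto
  then have "R \<ge> 1"
    using theta by (simp add: R)
  \<comment> \<open>\<open>\<kappa> \<le> 1\<close> is what \<open>energy_bound\<close> asks of the
    pairing; once the energy is bounded by \<open>R\<^sup>2\<close>,
    \<open>\<kappa> * R \<le> \<delta> / 2\<close> sharpens the pairing bound.\<close>
  define \<kappa> where "\<kappa> = min 1 (\<delta> / (2 * R))"
  have "\<kappa> > 0" "\<kappa> \<le> 1" "\<kappa> * R \<le> \<delta> / 2"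
    using \<open>\<delta> > 0\<close> \<open>R \<ge> 1\<close> mult_right_mono[of \<kappa> "\<delta> / (2 * R)" R] by (auto simp: \<kappa>_def)
  define \<sigma>' where "\<sigma>' = min \<sigma> (\<kappa>\<^sup>2 * (\<mu>_min * h0))"
  have "\<sigma>' > 0"
    using \<open>\<sigma> > 0\<close> \<open>\<kappa> > 0\<close> mu_min_pos h0_pos by (simp add: \<sigma>'_def)
  obtain v t where v: "supported A v" "\<delta> \<le> J A v" "residual2 A v < \<sigma>'"
    and t: "0 \<le> t" "t \<le> 1" "J A v \<le> J A (\<lambda>x. t * e x)"
    using mountain_pass_almost_critical[OF \<open>\<delta> > 0\<close> r barrier e far _ \<open>\<sigma>' > 0\<close>] low \<open>\<delta> > 0\<close>
    by (metis order_le_less_trans)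
  have pair: "\<bar>\<Sum>x\<in>A. v x * residual v x\<bar> \<le> \<kappa> * sqrt (energy A v)"
    using v(3) \<open>\<kappa> > 0\<close> by (intro residual_pairing_bound A v) (auto simp: \<sigma>'_def)
  also have "\<dots> \<le> 1 * sqrt (energy A v)"
    using \<open>\<kappa> \<le> 1\<close> by (intro mult_right_mono) (auto simp: energy_nonneg A v)
  finally have en: "energy A v \<le> R\<^sup>2"
    using c t eps by (intro energy_bound[OF A v(1) _ _ c(2) _ R]) (auto intro: order_trans)
  then have "sqrt (energy A v) \<le> R"
    using real_sqrt_le_mono[OF en] \<open>R \<ge> 1\<close> by simp
  then have "\<kappa> * sqrt (energy A v) \<le> \<kappa> * R"
    using \<open>\<kappa> > 0\<close> by simp
  then have "\<bar>\<Sum>x\<in>A. v x * residual v x\<bar> \<le> \<delta> / 2"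
    using pair \<open>\<kappa> * R \<le> \<delta> / 2\<close> by linarith
  then show thesis
    using that[OF u v(1) en v(2)] v(3) by (simp add: \<sigma>'_def)
qed

lemma residual_le_of_residual2:
  assumes "finite A" "residual2 A u < \<sigma>\<^sup>2" "\<sigma> > 0" "x \<in> A"
  shows "\<bar>residual u x\<bar> \<le> \<sigma>"
proof -
  have "(residual u x)\<^sup>2 \<le> residual2 A u"
    unfolding residual2_def using assms by (intro member_le_sum) auto
  then show ?thesis
    using assms abs_le_square_iff[of "residual u x" \<sigma>] by simp
qed

text \<open>From \<open>J A u \<le> 0\<close> and \<open>J_lower_bound\<close> the norm is at most
  8/3, rounded up to 3, times \<open>\<epsilon> * C\<close>; so the small family has mass of order
  \<open>\<epsilon>\<^sup>2\<close>.\<close>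

lemma small_solution_mass:
  assumes A: "finite A" and u: "supported A u" "energy A u \<le> r\<^sup>2" "J A u \<le> 0" and "r > 0"
    and small: "\<And>x s. \<bar>s\<bar> \<le> r / sqrt (\<mu>_min * h0) \<Longrightarrow> primitive trunc x s \<le> h0 / 8 * s\<^sup>2"
    and "finite K"
  shows "h0 * (\<Sum>x\<in>K. \<mu> x * (u x)\<^sup>2) \<le> 9 * (\<epsilon> * C)\<^sup>2"
proof -
  define p where "p = sqrt (energy A u)"
  have p: "p \<ge> 0" "p\<^sup>2 = energy A u"
    using energy_nonneg[OF A u(1)] by (auto simp: p_def)
  have "3 / 8 * p\<^sup>2 - \<epsilon> * C * p \<le> J A u"
    unfolding p(2) unfolding p_def using J_lower_bound[OF A u(1,2) _ small] \<open>r > 0\<close> by simp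
  then have "3 / 8 * p\<^sup>2 - \<epsilon> * C * p \<le> 0"
    using u(3) by linarith
  then have "3 * p * p \<le> 8 * (\<epsilon> * C) * p"
    by (simp add: power2_eq_square)
  moreover have "\<epsilon> * C \<ge> 0"
    using eps_nonneg C_nonneg by simp
  ultimately have "p \<le> 3 * (\<epsilon> * C)"
    using p(1) by (cases "p = 0") auto
  then have "energy A u \<le> (3 * (\<epsilon> * C))\<^sup>2"
    using p power_mono[of p "3 * (\<epsilon> * C)" 2] by simp
  moreover have "(\<Sum>x\<in>K. \<mu> x * (u x)\<^sup>2) = (\<Sum>x\<in>K \<inter> A. \<mu> x * (u x)\<^sup>2)"
    using u(1) \<open>finite K\<close> by (intro sum.mono_neutral_right) (auto simp: supported_def)
  moreover have "(\<Sum>x\<in>K \<inter> A. \<mu> x * (u x)\<^sup>2) \<le> (\<Sum>x\<in>A. \<mu> x * (u x)\<^sup>2)"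
    using A by (intro sum_mono2) (auto simp: less_imp_le[OF mu_pos])
  then have "h0 * (\<Sum>x\<in>K \<inter> A. \<mu> x * (u x)\<^sup>2) \<le> h0 * (\<Sum>x\<in>A. \<mu> x * (u x)\<^sup>2)"
    using h0_pos by simp
  ultimately show ?thesis
    using mass_le_energy[OF A u(1)] by (simp add: power_mult_distrib)
qed

text \<open>Where \<open>\<bar>v x\<bar>\<close> is at least \<open>c\<close>, the bound keeps
  \<open>h x\<close> below a constant, and sublevel sets of \<open>h\<close> are finite.\<close>

lemma decay_of_bound:
  assumes sub: "\<And>c. finite {x. h x < c}" and v: "\<And>x. \<bar>v x\<bar> \<le> R / sqrt (\<mu>_min * h x)" and "c > 0"
  shows "finite {x. \<bar>v x\<bar> \<ge> c}"
proof (rule finite_subset[OF _ sub])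
  show "{x. \<bar>v x\<bar> \<ge> c} \<subseteq> {x. h x < (R / c)\<^sup>2 / \<mu>_min + 1}"
  proof
    fix x assume "x \<in> {x. \<bar>v x\<bar> \<ge> c}"
    then have "c \<le> R / sqrt (\<mu>_min * h x)"
      using v[of x] by simp
    moreover have pos: "\<mu>_min * h x > 0"
      using mu_min_pos h_pos[of x] by simp
    ultimately have "sqrt (\<mu>_min * h x) \<le> R / c"
      using \<open>c > 0\<close> by (simp add: field_simps)
    then have "(sqrt (\<mu>_min * h x))\<^sup>2 \<le> (R / c)\<^sup>2"
      using pos by (intro power_mono) auto
    then have "\<mu>_min * h x \<le> (R / c)\<^sup>2"
      using pos by simp
    then have "h x \<le> (R / c)\<^sup>2 / \<mu>_min"
      using mu_min_pos by (simp add: pos_le_divide_eq mult.commute)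
    then show "x \<in> {x. h x < (R / c)\<^sup>2 / \<mu>_min + 1}"
      by simp
  qed
qed

lemma pos_solution_of_almost_solutions:
  assumes sub: "\<And>c. finite {x. h x < c}" and conn: "\<And>x y. (x, y) \<in> E\<^sup>*"
    and g: "\<exists>x. g x \<noteq> 0" and "\<epsilon> > 0" and S: "closed S" and "R \<ge> 0"
    and approx: "\<And>A \<sigma>. finite A \<Longrightarrow> x1 \<in> A \<Longrightarrow> \<sigma> > 0 \<Longrightarrow>
      \<exists>v\<in>S. supported A v \<and> energy A v \<le> R\<^sup>2 \<and> residual2 A v < \<sigma>"
  obtains v where "v \<in> S" "pos_solution E w \<mu> h f g \<epsilon> v"
proof -
  obtain v where v: "v \<in> S" "\<And>x. \<bar>v x\<bar> \<le> R / sqrt (\<mu>_min * h x)" "\<And>x. residual v x = 0"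
  proof (rule limit_of_almost_solutions[OF S])
    fix A :: "'v set" and \<sigma> :: real assume A: "finite A" and \<sigma>: "\<sigma> > 0"
    \<comment> \<open>Enlarging \<open>A\<close> by \<open>x1\<close> makes \<open>approx\<close>
      applicable; the tolerance is squared because \<open>residual2\<close> is a sum of
      squares.\<close>
    obtain v where v: "v \<in> S" "supported (insert x1 A) v" "energy (insert x1 A) v \<le> R\<^sup>2"
      "residual2 (insert x1 A) v < \<sigma>\<^sup>2"
      using approx[of "insert x1 A" "\<sigma>\<^sup>2"] A \<sigma> by auto
    show "\<exists>v\<in>S. (\<forall>x. \<bar>v x\<bar> \<le> R / sqrt (\<mu>_min * h x)) \<and> (\<forall>x\<in>A. \<bar>residual v x\<bar> \<le> \<sigma>)"
      using abs_le_of_energy[OF _ v(2,3) \<open>R \<ge> 0\<close>] residual_le_of_residual2[OF _ v(4) \<sigma>] A v(1)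
      by (intro bexI[of _ v]) auto
  qed blast
  have "v x \<ge> 0" for x
    using solution_nonneg[OF v(3) decay_of_bound[OF sub v(2)]] .
  then have "v x > 0" for x
    by (rule solution_pos[OF v(3) _ conn g \<open>\<epsilon> > 0\<close>])
  then show thesis
    using that[OF v(1)] pos_solution_of_residual[OF v(3)] by blast
qed

text \<open>The mass on \<open>K\<close> is at most \<open>\<delta> / (4 * L)\<close> for the small
  family and at least \<open>\<delta> / (2 * L)\<close> for the mountain pass family. Both
  conditions are closed since \<open>K\<close> is finite, so they survive the limit and keep the
  solutions apart.\<close>

lemma two_pos_solutions:
  assumes sub: "\<And>c. finite {x. h x < c}" and conn: "\<And>x y. (x, y) \<in> E\<^sup>*"
    and g: "\<exists>x. g x \<noteq> 0"
    and r: "r > 0" and \<delta>: "\<delta> = r\<^sup>2 / 4"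
    and small: "\<And>x s. \<bar>s\<bar> \<le> r / sqrt (\<mu>_min * h0) \<Longrightarrow> primitive trunc x s \<le> h0 / 8 * s\<^sup>2"
    and e: "\<And>x. x \<noteq> x1 \<Longrightarrow> e x = 0" "e x1 \<ge> 0"
    and far: "r\<^sup>2 < e x1 * schroedinger e x1"
    and low: "e x1 * schroedinger e x1 \<le> 2 * \<mu> x1 * primitive trunc x1 (e x1)"
    and R: "R = 1 + (\<theta> * (e x1 * schroedinger e x1 / 2) + 1 + \<theta> * C) / (\<theta> / 2 - 1)"
    and L: "\<And>x s. \<bar>s\<bar> \<le> R / sqrt (\<mu>_min * h0) \<Longrightarrow> trunc x s \<le> L * \<bar>s\<bar>" and "L > 0"
    and eps: "0 < \<epsilon>" "\<epsilon> \<le> 1" "\<epsilon> * C \<le> r / 8" "\<epsilon> * C * R \<le> \<delta> / 2" "36 * L * (\<epsilon> * C)\<^sup>2 \<le> h0 * \<delta>"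
  shows "\<exists>u v. u \<noteq> v \<and> pos_solution E w \<mu> h f g \<epsilon> u \<and> pos_solution E w \<mu> h f g \<epsilon> v"
proof -
  \<comment> \<open>Half the energy of \<open>e\<close>. The other two terms can only lower
    \<open>J\<close> along the segment from 0 to \<open>e\<close>, so \<open>c\<close> bounds
    \<open>J\<close> there, independently of \<open>A\<close> and \<open>\<epsilon>\<close>.\<close>
  define c where "c = e x1 * schroedinger e x1 / 2"
  have "\<delta> > 0"
    using r by (simp add: \<delta>)
  have "c \<ge> 0"
    using far zero_le_power2[of r] unfolding c_def by linarith
  then have "\<theta> * c + 1 + \<theta> * C \<ge> 0"
    using theta C_nonneg by auto
  then have "R \<ge> 1"
    using theta by (simp add: R c_def)
  \<comment> \<open>With this threshold the mass outside \<open>K\<close> is at most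
    \<open>\<delta> / (2 * L)\<close>, half of the total mass guaranteed by
    \<open>mass_lower_bound\<close>.\<close>
  define K where "K = {x. h x < 2 * L * R\<^sup>2 / \<delta>}"
  have "finite K"
    by (simp add: K_def sub)
  define mass where "mass u = (\<Sum>x\<in>K. \<mu> x * (u x)\<^sup>2)" for u
  have almost: "\<exists>u v. supported A u \<and> energy A u \<le> r\<^sup>2 \<and> residual2 A u < \<sigma> \<and> mass u \<le> \<delta> / (4 * L)
      \<and> supported A v \<and> energy A v \<le> R\<^sup>2 \<and> residual2 A v < \<sigma> \<and> mass v \<ge> \<delta> / (2 * L)"
    if A: "finite A" "x1 \<in> A" and "\<sigma> > 0" for A \<sigma>
  proof -
    have suppe: "supported A e"
      using e(1) A(2) unfolding supported_def by metis
    have only: "(\<Sum>x\<in>A. k x) = k x1" if "\<And>x. x \<noteq> x1 \<Longrightarrow> k x = 0" for k :: "'v \<Rightarrow> real"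
      using sum.mono_neutral_right[of A "{x1}" k] A that by auto
    have ene: "energy A e = 2 * c"
      unfolding energy_def c_def using only[of "\<lambda>x. e x * schroedinger e x"] by (simp add: e(1))
    have J_le: "J A (\<lambda>x. t * e x) \<le> t\<^sup>2 * c - \<mu> x1 * primitive trunc x1 (t * e x1)"
      if "0 \<le> t" for t
    proof -
      have "energy A (\<lambda>x. 0 + t * e x) = t\<^sup>2 * (2 * c)"
        using energy_add_scaleR[OF A(1) _ suppe, of "\<lambda>x. 0" t]
        by (simp add: supported_def schroedinger_def ene energy_def[of A "\<lambda>x. 0"])
      moreover have "(\<Sum>x\<in>A. \<mu> x * primitive trunc x (t * e x)) = \<mu> x1 * primitive trunc x1 (t * e x1)"
        by (rule only) (simp add: e(1) primitive_trunc_neg)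
      moreover have "(\<Sum>x\<in>A. \<mu> x * g x * (t * e x)) = \<mu> x1 * g x1 * (t * e x1)"
        by (rule only) (simp add: e(1))
      moreover have "\<epsilon> * (\<mu> x1 * g x1 * (t * e x1)) \<ge> 0"
        using eps_nonneg g_nonneg[of x1] mu_pos[of x1] e(2) that by simp
      ultimately show ?thesis
        by (simp add: J_def)
    qed
    obtain u v where u: "supported A u" "energy A u \<le> r\<^sup>2" "J A u \<le> 0" "residual2 A u < \<sigma>"
      and v: "supported A v" "energy A v \<le> R\<^sup>2" "\<delta> \<le> J A v" "residual2 A v < \<sigma>"
        "\<bar>\<Sum>x\<in>A. v x * residual v x\<bar> \<le> \<delta> / 2"
    proof (rule almost_solutions_exist[OF A(1) suppe r \<delta> small _ _ _ \<open>c \<ge> 0\<close> R[folded c_def] eps(2,3) \<open>\<sigma> > 0\<close>])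
      show "r\<^sup>2 < energy A e"
        using far by (simp add: ene c_def)
      show "J A e \<le> 0"
        using J_le[of 1] low by (simp add: c_def)
      show "J A (\<lambda>x. t * e x) \<le> c" if "0 \<le> t" "t \<le> 1" for t
      proof -
        have "t\<^sup>2 * c \<le> 1 * c"
          using that \<open>c \<ge> 0\<close> by (intro mult_right_mono) (auto simp: power_le_one)
        moreover have "0 \<le> \<mu> x1 * primitive trunc x1 (t * e x1)"
          using mu_pos[of x1] primitive_trunc_nonneg by simp
        ultimately show ?thesis
          using J_le[OF that(1)] by linarith
      qed
    qed blast
    \<comment> \<open>The 36 in the bound on \<open>\<epsilon>\<close> is this 4 times the 9 of
      \<open>small_solution_mass\<close>.\<close>
    have "h0 * (L * (4 * mass u)) = 4 * L * (h0 * mass u)"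
      by simp
    also have "\<dots> \<le> 4 * L * (9 * (\<epsilon> * C)\<^sup>2)"
      unfolding mass_def using small_solution_mass[OF A(1) u(1-3) r small \<open>finite K\<close>] \<open>L > 0\<close>
      by (intro mult_left_mono) auto
    also have "\<dots> \<le> h0 * \<delta>"
      using eps(5) by simp
    finally have massu: "mass u \<le> \<delta> / (4 * L)"
      using h0_pos \<open>L > 0\<close> by (simp add: field_simps)
    have "\<delta> \<le> L * (\<Sum>x\<in>A. \<mu> x * (v x)\<^sup>2)"
      using \<open>R \<ge> 1\<close> by (intro mass_lower_bound[OF A(1) v(1,5,3,2) _ eps(4) L]) auto
    also have "\<dots> \<le> L * (mass v + R\<^sup>2 / (2 * L * R\<^sup>2 / \<delta>))"
      unfolding mass_def using \<open>L > 0\<close> \<open>R \<ge> 1\<close> \<open>\<delta> > 0\<close>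
      by (intro mult_left_mono mass_concentrated[OF A(1) v(1,2) _ \<open>finite K\<close>]) (auto simp: K_def)
    also have "\<dots> = L * mass v + \<delta> / 2"
      using \<open>L > 0\<close> \<open>R \<ge> 1\<close> by (simp add: field_simps)
    finally have "mass v \<ge> \<delta> / (2 * L)"
      using \<open>L > 0\<close> by (simp add: field_simps)
    then show ?thesis
      using u v massu by blast
  qed
  have cont: "continuous_on UNIV mass"
    unfolding mass_def by (intro continuous_intros continuous_on_product_coordinates)
  obtain u where u: "mass u \<le> \<delta> / (4 * L)" "pos_solution E w \<mu> h f g \<epsilon> u"
  proof (rule pos_solution_of_almost_solutions[OF sub conn g eps(1), of "{u. mass u \<le> \<delta> / (4 * L)}" r])
    show "closed {u. mass u \<le> \<delta> / (4 * L)}"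
      by (intro closed_Collect_le cont continuous_intros)
    show "r \<ge> 0" using r by simp
    fix A \<sigma> assume "finite A" "x1 \<in> A" "(\<sigma>::real) > 0"
    then show "\<exists>v\<in>{u. mass u \<le> \<delta> / (4 * L)}. supported A v \<and> energy A v \<le> r\<^sup>2 \<and> residual2 A v < \<sigma>"
      using almost by blast
  qed auto
  obtain v where v: "mass v \<ge> \<delta> / (2 * L)" "pos_solution E w \<mu> h f g \<epsilon> v"
  proof (rule pos_solution_of_almost_solutions[OF sub conn g eps(1), of "{u. mass u \<ge> \<delta> / (2 * L)}" R])
    show "closed {u. mass u \<ge> \<delta> / (2 * L)}"
      by (intro closed_Collect_le cont continuous_intros)
    show "R \<ge> 0" using \<open>R \<ge> 1\<close> by simp
    fix A \<sigma> assume "finite A" "x1 \<in> A" "(\<sigma>::real) > 0"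
    then show "\<exists>v\<in>{u. mass u \<ge> \<delta> / (2 * L)}. supported A v \<and> energy A v \<le> R\<^sup>2 \<and> residual2 A v < \<sigma>"
      using almost by blast
  qed auto
  have "\<delta> / (4 * L) < \<delta> / (2 * L)"
    using \<open>\<delta> > 0\<close> \<open>L > 0\<close> by (simp add: field_simps)
  then have "u \<noteq> v"
    using u v by auto
  then show ?thesis
    using u v by blast
qed

end

section \<open>Choice of the constants\<close>

theorem theorem4:
  fixes E :: "('v \<times> 'v) set"
    and w :: "'v \<Rightarrow> 'v \<Rightarrow> real"
    and \<mu> h g :: "'v \<Rightarrow> real"
    and f :: "'v \<Rightarrow> real \<Rightarrow> real"
    and x0 :: 'v
    and \<mu>_min h0 \<theta> :: real
  assumes graph: "sym E"
    and loc_finite: "\<And>x. finite (E `` {x})"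
    and w_pos: "\<And>x y. (x, y) \<in> E \<Longrightarrow> w x y > 0"
    and w_sym: "\<And>x y. (x, y) \<in> E \<Longrightarrow> w x y = w y x"
    and mu_min_pos: "\<mu>_min > 0"
    and mu_ge: "\<And>x. \<mu> x \<ge> \<mu>_min"
    and h0_pos: "h0 > 0"
    and h_ge: "\<And>x. h x \<ge> h0"
    and h_coercive: "\<forall>C. \<exists>N::nat. \<forall>x. graph_dist E x x0 \<ge> enat N \<longrightarrow> h x \<ge> C"
    and f_lipschitz: "loc_lipschitz f"
    and theta: "\<theta> > 2"
    and f_superlinear:
      "\<And>x s. s > 0 \<Longrightarrow> 0 < \<theta> * primitive f x s \<and> \<theta> * primitive f x s \<le> s * f x s"
    and f_near_zero:
      "\<And>x. Limsup (at_right 0) (\<lambda>s. ereal (2 * primitive f x s / s\<^sup>2)) < ereal (lambda1 E w \<mu> h)"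
    and g_dual: "g \<in> H_dual E w \<mu> h"
    and g_nonneg: "\<And>x. g x \<ge> 0"
    and g_nonzero: "\<exists>x. g x \<noteq> 0"
  shows "\<exists>\<epsilon>1>0. \<forall>\<epsilon>. 0 < \<epsilon> \<and> \<epsilon> < \<epsilon>1 \<longrightarrow>
           (\<exists>u v. u \<noteq> v \<and> pos_solution E w \<mu> h f g \<epsilon> u \<and> pos_solution E w \<mu> h f g \<epsilon> v)"
proof -
  interpret weighted_graph E w \<mu> h \<mu>_min h0
    by unfold_locales (fact assms)+
  interpret superlinear f \<theta>
    by unfold_locales (fact assms)+
  obtain C where C: "C \<ge> 0"
    "\<And>A u. finite A \<Longrightarrow> supported A u \<Longrightarrow> \<bar>\<Sum>x\<in>A. \<mu> x * g x * u x\<bar> \<le> C * sqrt (energy A u)"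
    using H_dual_bound[OF g_dual] by blast
  obtain \<eta> where "\<eta> > 0" and \<eta>: "\<And>x s. \<bar>s\<bar> \<le> \<eta> \<Longrightarrow> primitive trunc x s \<le> h0 / 8 * s\<^sup>2"
    using primitive_trunc_small[of "h0 / 8"] h0_pos by auto
  \<comment> \<open>The radius at which the pointwise bound for energy \<open>r\<^sup>2\<close>
    equals the threshold \<open>\<eta>\<close>.\<close>
  define r where "r = \<eta> * sqrt (\<mu>_min * h0)"
  have r: "r > 0" "r / sqrt (\<mu>_min * h0) = \<eta>"
    using \<open>\<eta> > 0\<close> mu_min_pos h0_pos by (auto simp: r_def)
  define d where "d = (\<lambda>x. if x = x0 then 1 else 0 :: real)"
  define k where "k = schroedinger d x0"
  have "k > 0"
  proof -
    have "(\<Sum>y\<in>E `` {x0}. w x0 y * (d x0 - d y)) \<ge> 0"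
      by (intro sum_nonneg mult_nonneg_nonneg) (auto simp: d_def less_imp_le[OF w_pos])
    moreover have "\<mu> x0 * h x0 * d x0 > 0"
      using mu_pos[of x0] h_pos[of x0] by (simp add: d_def)
    ultimately show ?thesis
      by (simp add: k_def schroedinger_def)
  qed
  \<comment> \<open>The first bound, strict thanks to the added 1, puts \<open>e\<close> outside the
    sphere; the last one makes \<open>J\<close> nonpositive at \<open>e\<close>.\<close>
  obtain s where s: "s \<ge> r / sqrt k + 1" "s > 0" "primitive trunc x0 s \<ge> k / (2 * \<mu> x0) * s\<^sup>2"
    using primitive_trunc_superquadratic by blast
  define e where "e x = 0 + s * d x" for x
  have e: "e x0 * schroedinger e x0 = s\<^sup>2 * k"
    unfolding e_def schroedinger_add_scaleR k_def
    by (simp add: d_def schroedinger_def[of "\<lambda>x. 0"] power2_eq_square)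
  have "r / sqrt k < s"
    using s(1) by simp
  then have "r < s * sqrt k"
    using \<open>k > 0\<close> by (simp add: field_simps)
  then have "r\<^sup>2 < (s * sqrt k)\<^sup>2"
    using r(1) by (intro power_strict_mono) auto
  then have far: "r\<^sup>2 < s\<^sup>2 * k"
    using \<open>k > 0\<close> by (simp add: power_mult_distrib)
  have low: "s\<^sup>2 * k \<le> 2 * \<mu> x0 * primitive trunc x0 (e x0)"
    using s(3) mu_pos[of x0] by (simp add: e_def d_def field_simps)
  define \<delta> where "\<delta> = r\<^sup>2 / 4"
  \<comment> \<open>The constant of \<open>energy_bound\<close> for
    \<open>c = s\<^sup>2 * k / 2\<close>. It and the Lipschitz constant \<open>L\<close> on the
    corresponding range of values are fixed before \<open>\<epsilon>\<close>.\<close>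
  define R where "R = 1 + (\<theta> * (s\<^sup>2 * k / 2) + 1 + \<theta> * C) / (\<theta> / 2 - 1)"
  have "\<theta> * (s\<^sup>2 * k / 2) \<ge> 0" "\<theta> * C \<ge> 0"
    using theta \<open>k > 0\<close> C(1) by auto
  then have "R \<ge> 1"
    using theta by (simp add: R_def)
  have "\<delta> > 0"
    using r(1) by (simp add: \<delta>_def)
  obtain L where "L > 0" and L: "\<And>x s t. \<bar>s\<bar> \<le> R / sqrt (\<mu>_min * h0) \<Longrightarrow>
      \<bar>t\<bar> \<le> R / sqrt (\<mu>_min * h0) \<Longrightarrow> \<bar>trunc x s - trunc x t\<bar> \<le> L * \<bar>s - t\<bar>"
    using trunc_lipschitz by blast
  have trunc_le: "trunc x s \<le> L * \<bar>s\<bar>" if "\<bar>s\<bar> \<le> R / sqrt (\<mu>_min * h0)" for x s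
    using L[OF that, of 0 x] order_trans[OF abs_ge_zero that] trunc_zero[of 0 x] by simp
  \<comment> \<open>The three upper bounds for \<open>\<epsilon> * C\<close>: for the barrier, for
    the lower mass bound of the mountain pass family, and for the upper mass bound of the small
    family.\<close>
  define y where "y = min (r / 8) (min (\<delta> / (2 * R)) (sqrt (h0 * \<delta> / (36 * L))))"
  have "y > 0"
    using r(1) \<open>\<delta> > 0\<close> \<open>R \<ge> 1\<close> h0_pos \<open>L > 0\<close> by (simp add: y_def)
  show ?thesis
  \<comment> \<open>\<open>C\<close> may be 0, hence the denominator \<open>C + 1\<close>; the bound
    1 gives the \<open>\<epsilon> \<le> 1\<close> of \<open>energy_bound\<close>.\<close>
  proof (intro exI[of _ "min 1 (y / (C + 1))"] conjI allI impI)
    show "0 < min 1 (y / (C + 1))"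
      using \<open>y > 0\<close> C(1) by simp
    fix \<epsilon> assume eps: "0 < \<epsilon> \<and> \<epsilon> < min 1 (y / (C + 1))"
    then have "\<epsilon> * (C + 1) \<le> y"
      using C(1) by (simp add: field_simps)
    moreover have "\<epsilon> * C \<le> \<epsilon> * (C + 1)"
      using eps by simp
    ultimately have y: "\<epsilon> * C \<le> y"
      by linarith
    have "\<epsilon> * C \<ge> 0"
      using eps C(1) by simp
    interpret perturbed_problem E w \<mu> h \<mu>_min h0 f \<theta> g C \<epsilon>
      by unfold_locales (fact C, fact C, fact g_nonneg, use eps in simp)
    show "\<exists>u v. u \<noteq> v \<and> pos_solution E w \<mu> h f g \<epsilon> u \<and> pos_solution E w \<mu> h f g \<epsilon> v"
    proof (rule two_pos_solutions[OF finite_sublevel[OF h_coercive] connected_graph[OF h_coercive]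
          g_nonzero r(1) \<delta>_def _ _ _ _ _ _ trunc_le \<open>L > 0\<close>])
      show "primitive trunc x s \<le> h0 / 8 * s\<^sup>2" if "\<bar>s\<bar> \<le> r / sqrt (\<mu>_min * h0)" for x s
        using that unfolding r(2) by (rule \<eta>)
      show "e x = 0" if "x \<noteq> x0" for x
        using that by (simp add: e_def d_def)
      show "e x0 \<ge> 0"
        using s(2) by (simp add: e_def d_def)
      show "r\<^sup>2 < e x0 * schroedinger e x0"
        unfolding e by (rule far)
      show "e x0 * schroedinger e x0 \<le> 2 * \<mu> x0 * primitive trunc x0 (e x0)"
        unfolding e by (rule low)
      show "R = 1 + (\<theta> * (e x0 * schroedinger e x0 / 2) + 1 + \<theta> * C) / (\<theta> / 2 - 1)"
        unfolding e by (rule R_def)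
      show "0 < \<epsilon>" "\<epsilon> \<le> 1"
        using eps by auto
      show "\<epsilon> * C \<le> r / 8"
        using y by (simp add: y_def)
      have "\<epsilon> * C \<le> \<delta> / (2 * R)"
        using y by (simp add: y_def)
      then show "\<epsilon> * C * R \<le> \<delta> / 2"
        using \<open>R \<ge> 1\<close> by (simp add: field_simps)
      have "(\<epsilon> * C)\<^sup>2 \<le> (sqrt (h0 * \<delta> / (36 * L)))\<^sup>2"
        using y \<open>\<epsilon> * C \<ge> 0\<close> by (intro power_mono) (auto simp: y_def)
      also have "\<dots> = h0 * \<delta> / (36 * L)"
        using h0_pos \<open>\<delta> > 0\<close> \<open>L > 0\<close> by (simp del: times_divide_eq_right)
      finally show "36 * L * (\<epsilon> * C)\<^sup>2 \<le> h0 * \<delta>"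
        using \<open>L > 0\<close> by (simp add: pos_le_divide_eq mult_ac)
    qed
  qed
qed

end
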